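(* Let $\mathcal T=\sum_{i=1}^R\lambda_i\,a_i\otimes b_i\otimes c_i\in\mathbb R^{d\times d\times d}$ with $\lambda_1>\cdots>\lambda_R>0$, where $A=[a_1,\dots,a_R]$, $B=[b_1,\dots,b_R]$, $C=[c_1,\dots,c_R]$ have orthonormal columns, let $1\le r\le R$, and let $Q_A^{(0)},Q_B^{(0)},Q_C^{(0)}$ be the outputs of the Slice-Based Initialization applied to the noiseless tensor $\mathcal T$ with $J$ steps of matrix subspace iteration. Assume that the constant $\mathsf C$ in the matrix subspace iteration bound (see context) satisfies $\mathsf C\ge1$. Then, almost surely with respect to the random initialization of the matrix subspace iteration, with $J=O\big(\log(\mathsf C)/\log|\lambda_r/\lambda_{r+1}|\big)$ steps one has $$\tan(A_{[r]},Q_A^{(0)})<1,\qquad \tan(B_{[r]},Q_B^{(0)})<1,\qquad \tan(C_{[r]},Q_C^{(0)})<1.$$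
   Context: Conventions: $\lambda_{R+1}:=0$; $X_{[r]}$ denotes the first $r$ columns of $X$; $e_i$ is the $i$th standard basis vector; $\mathcal T(X,Y,Z)_{ijk}=\sum_{a,b,c}\mathcal T_{abc}X_{ai}Y_{bj}Z_{ck}$ (modes contracted with vectors dropped). For orthonormal basis matrices $M_1,M_2$ of two $m$-dimensional subspaces of $\mathbb R^d$ and $M_2^c$ an orthonormal basis matrix of the orthogonal complement of the column space of $M_2$, $\tan(M_1,M_2)=\sigma_{\max}(M_1^\top M_2^c)/\sigma_{\min}(M_1^\top M_2)$. Slice-Based Initialization. If $\mathcal T$ is not symmetric, set $M^A=\sum_{i=1}^d\mathcal T(I,I,e_i)\mathcal T(I,I,e_i)^\top$, $M^B=\sum_{i=1}^d\mathcal T(e_i,I,I)\mathcal T(e_i,I,I)^\top$, $M^C=\sum_{i=1}^d\mathcal T(I,e_i,I)^\top\mathcal T(I,e_i,I)$. If $\mathcal T$ is symmetric (then $A=B=C$), set $M^A=\mathcal T(I,I,v^C)$, $M^B=\mathcal T(v^A,I,I)$, $M^C=\mathcal T(I,v^B,I)^\top$ with $v^C_i=\mathrm{trace}\,\mathcal T(I,I,e_i)$, $v^A_i=\mathrm{trace}\,\mathcal T(e_i,I,I)$, $v^B_i=\mathrm{trace}\,\mathcal T(I,e_i,I)$. For each $M\in\{M^A,M^B,M^C\}$ run matrix subspace iteration: draw a random $d\times r$ matrix $Q^{(0)}$ with orthonormal columns (Haar distributed), and for $j=1,\dots,J$ let $Q^{(j)}R^{(j)}$ be the QR factorization of $MQ^{(j-1)}$.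 The outputs $Q^{(J)}$ are denoted $Q_A^{(0)},Q_B^{(0)},Q_C^{(0)}$ respectively. The constant $\mathsf C$: a finite constant, depending on $M$ and on the random initialization $Q^{(0)}$ but not on the number of steps, such that for all $k\ge1$ the $k$th iterate satisfies $\tan(U_{[r]},Q^{(k)})\le\mathsf C\,|\sigma_{r+1}(M)/\sigma_r(M)|^k$, where the columns of $U_{[r]}$ span the invariant subspace of $M$ belonging to its $r$ dominant eigenvalues and $\sigma_p(M)$ is the $p$th singular value. *)

theory Defs
  imports "HOL-Probability.Probability" "Jordan_Normal_Form.Char_Poly"
begin

unbundle no vec_syntax
hide_const (open) Finite_Cartesian_Product.vec Finite_Cartesian_Product.mat

text \<open>
  Matrices are those of \<open>Jordan_Normal_Form\<close>: dimensions are natural numbers, and entries and columns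
  are counted from 0. Weights and singular values keep the usual numbering from 1, so the weight
  \<open>lam (l + 1)\<close> belongs to the columns with index \<open>l\<close>.
\<close>

definition orthonormal_cols :: "nat \<Rightarrow> nat \<Rightarrow> real mat \<Rightarrow> bool" where
  "orthonormal_cols n m X \<longleftrightarrow> X \<in> carrier_mat n m \<and> transpose_mat X * X = 1\<^sub>m m"

definition first_cols :: "real mat \<Rightarrow> nat \<Rightarrow> real mat" where
  "first_cols X r = mat_of_cols (dim_row X) (take r (cols X))"

definition mat_trace :: "real mat \<Rightarrow> real" where
  "mat_trace X = (\<Sum>i<dim_row X. X $$ (i, i))"

definition col_space :: "real mat \<Rightarrow> real vec set" where
  "col_space X = {X *\<^sub>v x | x. x \<in> carrier_vec (dim_col X)}"

text \<open>
  Square roots of the eigenvalues of \<open>X\<^sup>T X\<close>, with multiplicity, in decreasing order. The list has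
  length \<open>dim_col X\<close>; beyond position \<open>min (dim_row X) (dim_col X)\<close> it contains only zeros.
\<close>

definition singular_values :: "real mat \<Rightarrow> real list" where
  "singular_values X =
     rev (sorted_list_of_multiset (image_mset sqrt (proots (char_poly (transpose_mat X * X)))))"

text \<open>
  The \<open>p\<close>-th singular value, \<open>p \<ge> 1\<close>, with value 0 past the end of the list. In particular the largest
  singular value of a matrix without columns is 0.
\<close>

definition sigma :: "nat \<Rightarrow> real mat \<Rightarrow> real" where
  "sigma p X = (if 1 \<le> p \<and> p \<le> length (singular_values X) then singular_values X ! (p - 1) else 0)"

definition sigma_max :: "real mat \<Rightarrow> real" where
  "sigma_max X = sigma 1 X"

definition sigma_min :: "real mat \<Rightarrow> real" where
  "sigma_min X = sigma (min (dim_row X) (dim_col X)) X"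

definition is_complement_basis :: "real mat \<Rightarrow> real mat \<Rightarrow> bool" where
  "is_complement_basis X N \<longleftrightarrow>
     orthonormal_cols (dim_row X) (dim_col N) N \<and>
     col_space N = {v \<in> carrier_vec (dim_row X). \<forall>x \<in> col_space X. x \<bullet> v = 0}"

text \<open>
  The value does not depend on the chosen basis of the orthogonal complement. It is infinite, rather
  than the 0 given by real division, when the denominator vanishes.
\<close>

definition subspace_tan :: "real mat \<Rightarrow> real mat \<Rightarrow> ereal" where
  "subspace_tan X Y =
     (let N = (SOME N. is_complement_basis Y N);
          s = sigma_min (transpose_mat X * Y)
      in if s = 0 then \<infinity> else ereal (sigma_max (transpose_mat X * N) / s))"

text \<open>
  A \<open>d \<times> d \<times> d\<close> tensor is a function of three indices, of which only the values at indices below \<open>d\<close>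
  are used.
\<close>

type_synonym tensor = "nat \<Rightarrow> nat \<Rightarrow> nat \<Rightarrow> real"

definition cp_decomposition ::
    "nat \<Rightarrow> nat \<Rightarrow> tensor \<Rightarrow> (nat \<Rightarrow> real) \<Rightarrow> real mat \<Rightarrow> real mat \<Rightarrow> real mat \<Rightarrow> bool" where
  "cp_decomposition d R T lam A B C \<longleftrightarrow>
     (\<forall>i<d. \<forall>j<d. \<forall>k<d.
        T i j k = (\<Sum>l<R. lam (l + 1) * A $$ (i, l) * B $$ (j, l) * C $$ (k, l)))"

definition symmetric_tensor :: "nat \<Rightarrow> tensor \<Rightarrow> bool" where
  "symmetric_tensor d T \<longleftrightarrow>
     (\<forall>i<d. \<forall>j<d. \<forall>k<d. T i j k = T j i k \<and> T i j k = T i k j)"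

definition multilinear :: "nat \<Rightarrow> tensor \<Rightarrow> real mat \<Rightarrow> real mat \<Rightarrow> real mat \<Rightarrow> tensor" where
  "multilinear d T X Y Z i j k =
     (\<Sum>a<d. \<Sum>b<d. \<Sum>c<d. T a b c * X $$ (a, i) * Y $$ (b, j) * Z $$ (c, k))"

text \<open>
  \<open>contract1 d T v\<close>, \<open>contract2 d T v\<close>, \<open>contract3 d T v\<close> are \<open>T(v, I, I)\<close>, \<open>T(I, v, I)\<close>, \<open>T(I, I, v)\<close>:
  the vector is a matrix with one column, and its mode is dropped.
\<close>

definition contract1 :: "nat \<Rightarrow> tensor \<Rightarrow> real vec \<Rightarrow> real mat" where
  "contract1 d T v =
     Matrix.mat d d (\<lambda>(j, k). multilinear d T (mat_of_cols d [v]) (1\<^sub>m d) (1\<^sub>m d) 0 j k)"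

definition contract2 :: "nat \<Rightarrow> tensor \<Rightarrow> real vec \<Rightarrow> real mat" where
  "contract2 d T v =
     Matrix.mat d d (\<lambda>(i, k). multilinear d T (1\<^sub>m d) (mat_of_cols d [v]) (1\<^sub>m d) i 0 k)"

definition contract3 :: "nat \<Rightarrow> tensor \<Rightarrow> real vec \<Rightarrow> real mat" where
  "contract3 d T v =
     Matrix.mat d d (\<lambda>(i, j). multilinear d T (1\<^sub>m d) (1\<^sub>m d) (mat_of_cols d [v]) i j 0)"

definition sum_mats :: "nat \<Rightarrow> (nat \<Rightarrow> real mat) \<Rightarrow> real mat" where
  "sum_mats d F = Matrix.mat d d (\<lambda>(p, q). \<Sum>i<d. F i $$ (p, q))"

definition slice_mat_A :: "nat \<Rightarrow> tensor \<Rightarrow> real mat" where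
  "slice_mat_A d T =
     (if symmetric_tensor d T
      then contract3 d T (Matrix.vec d (\<lambda>i. mat_trace (contract3 d T (unit_vec d i))))
      else sum_mats d
             (\<lambda>i. contract3 d T (unit_vec d i) * transpose_mat (contract3 d T (unit_vec d i))))"

definition slice_mat_B :: "nat \<Rightarrow> tensor \<Rightarrow> real mat" where
  "slice_mat_B d T =
     (if symmetric_tensor d T
      then contract1 d T (Matrix.vec d (\<lambda>i. mat_trace (contract1 d T (unit_vec d i))))
      else sum_mats d
             (\<lambda>i. contract1 d T (unit_vec d i) * transpose_mat (contract1 d T (unit_vec d i))))"

definition slice_mat_C :: "nat \<Rightarrow> tensor \<Rightarrow> real mat" where
  "slice_mat_C d T =
     (if symmetric_tensor d T
      then transpose_mat
             (contract2 d T (Matrix.vec d (\<lambda>i. mat_trace (contract2 d T (unit_vec d i)))))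
      else sum_mats d
             (\<lambda>i. transpose_mat (contract2 d T (unit_vec d i)) * contract2 d T (unit_vec d i)))"

definition entries :: "nat \<Rightarrow> nat \<Rightarrow> real mat \<Rightarrow> (nat \<times> nat \<Rightarrow> real)" where
  "entries n m X = (\<lambda>ij \<in> {..<n} \<times> {..<m}. X $$ ij)"

abbreviation entry_space :: "nat \<Rightarrow> nat \<Rightarrow> (nat \<times> nat \<Rightarrow> real) measure" where
  "entry_space n m \<equiv> (\<Pi>\<^sub>M ij \<in> {..<n} \<times> {..<m}. borel)"

text \<open>
  The Haar measure on the Stiefel manifold of \<open>d \<times> r\<close> matrices with orthonormal columns is its unique
  probability measure that is invariant under the action of the orthogonal group from the left.
\<close>

definition haar_orthonormal :: "'w measure \<Rightarrow> nat \<Rightarrow> nat \<Rightarrow> ('w \<Rightarrow> real mat) \<Rightarrow> bool" where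
  "haar_orthonormal \<Omega> d r X \<longleftrightarrow>
     (\<forall>\<omega> \<in> space \<Omega>. orthonormal_cols d r (X \<omega>)) \<and>
     (\<lambda>\<omega>. entries d r (X \<omega>)) \<in> \<Omega> \<rightarrow>\<^sub>M entry_space d r \<and>
     (\<forall>G. orthonormal_cols d d G \<longrightarrow>
        distr \<Omega> (entry_space d r) (\<lambda>\<omega>. entries d r (G * X \<omega>)) =
        distr \<Omega> (entry_space d r) (\<lambda>\<omega>. entries d r (X \<omega>)))"

text \<open>No sign convention is imposed on the diagonal of the triangular factor.\<close>

definition qr_factorization :: "nat \<Rightarrow> nat \<Rightarrow> real mat \<Rightarrow> real mat \<Rightarrow> real mat \<Rightarrow> bool" where
  "qr_factorization d r X Q S \<longleftrightarrow>
     orthonormal_cols d r Q \<and> S \<in> carrier_mat r r \<and> upper_triangular S \<and> X = Q * S"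

definition subspace_iteration :: "nat \<Rightarrow> nat \<Rightarrow> real mat \<Rightarrow> (nat \<Rightarrow> real mat) \<Rightarrow> bool" where
  "subspace_iteration d r M Q \<longleftrightarrow> (\<forall>j\<ge>1. \<exists>S. qr_factorization d r (M * Q (j - 1)) (Q j) S)"

text \<open>
  The columns of \<open>U\<close> are an orthonormal basis of the invariant subspace of \<open>M\<close> belonging to its \<open>r\<close>
  dominant eigenvalues: \<open>S\<close> is the restriction of \<open>M\<close> to this subspace, and its eigenvalues exceed in
  modulus the remaining eigenvalues of \<open>M\<close>, which are the roots of \<open>g\<close>.
\<close>

definition dominant_basis :: "nat \<Rightarrow> nat \<Rightarrow> real mat \<Rightarrow> real mat \<Rightarrow> bool" where
  "dominant_basis d r M U \<longleftrightarrow>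
     orthonormal_cols d r U \<and>
     (\<exists>S g. S \<in> carrier_mat r r \<and> M * U = U * S \<and> char_poly M = char_poly S * g \<and>
        (\<forall>x y. poly (map_poly complex_of_real (char_poly S)) x = 0 \<longrightarrow>
               poly (map_poly complex_of_real g) y = 0 \<longrightarrow> cmod y < cmod x))"

text \<open>
  \<open>c\<close> is a constant in the convergence bound for the iterates \<open>Q\<close>. Any two admissible \<open>U\<close> have the
  same column space, hence the same tangents.
\<close>

definition iteration_constant ::
    "nat \<Rightarrow> nat \<Rightarrow> real mat \<Rightarrow> (nat \<Rightarrow> real mat) \<Rightarrow> real \<Rightarrow> bool" where
  "iteration_constant d r M Q c \<longleftrightarrow>
     (\<forall>U. dominant_basis d r M U \<longrightarrow>
        (\<forall>k\<ge>1. subspace_tan U (Q k) \<le> ereal (c * \<bar>sigma (r + 1) M / sigma r M\<bar> ^ k)))"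

text \<open>
  \<open>ln c / ln \<bar>lam r / lam (r + 1)\<bar>\<close>, where a vanishing \<open>lam (r + 1)\<close> makes the denominator infinite.
\<close>

definition step_scale :: "(nat \<Rightarrow> real) \<Rightarrow> nat \<Rightarrow> real \<Rightarrow> real" where
  "step_scale lam r c =
     (if lam (r + 1) = 0 then 0 else ln c / ln \<bar>lam r / lam (r + 1)\<bar>)"

end

theory Submission
  imports Defs
begin

no_notation inner (infix "\<bullet>" 70)

text \<open>
  For symmetric as well as for other tensors, orthonormality of the factors turns the slice matrix of
  \<open>A\<close> into \<open>\<Sum>\<^sub>l \<lambda>\<^sub>l\<^sup>2 a\<^sub>l a\<^sub>l\<^sup>T\<close>; in the symmetric case because the contraction of \<open>T\<close> with \<open>c\<^sub>l\<close> is a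
  symmetric matrix of rank one, so that \<open>a\<^sub>l = \<plusminus> b\<^sub>l\<close>. The singular value ratio in the convergence
  bound is therefore \<open>(\<lambda>\<^sub>r\<^sub>+\<^sub>1 / \<lambda>\<^sub>r)\<^sup>2\<close>, and \<open>ln c / ln (\<lambda>\<^sub>r / \<lambda>\<^sub>r\<^sub>+\<^sub>1)\<close> steps bring it below \<open>1\<close>.

  The bound itself holds with a finite constant as soon as \<open>U\<^sup>T Q\<close> is nonsingular for the random
  start \<open>Q\<close>. Only the rotation invariance of the distribution of \<open>Q\<close> is used for this: if the event
  that \<open>U\<^sup>T Q\<close> is singular had positive probability, then so would, equally, infinitely many of its
  rotated copies, but rotations along a moment curve can be chosen such that no point lies in more
  than finitely many of them.
\<close>

subsection \<open>Orthonormal columns\<close>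

text \<open>Singular values enter as roots of a characteristic polynomial, the complement basis as
  an arbitrary choice, and an admissible constant must serve every basis of the dominant subspace.
  All three are met by one quadratic inequality,
  \<open>|x|^2 \<le> (1 + \<epsilon>\<^sup>2) * |U^T Q x|^2\<close>: to exploit it, each singular
  value only has to be attained at some vector, and the projection norm in it is the same for every
  dominant basis because the leading \<open>r\<close> eigenvalues are simple. The step count carries
  the constant 1 because the ratio of weights is squared: one factor absorbs \<open>c\<close>, the
  other gives strictness. A general rotation moves all rows of an \<open>r\<close> by
  \<open>r\<close> block, and its determinant is then hard to follow. Passing through the leading
  minors one size at a time allows rotations that fix the earlier rows, so that each minor is linear
  in the single row of it that moves.\<close>

lemma orthonormal_cols_carrier: "orthonormal_cols n m X \<Longrightarrow> X \<in> carrier_mat n m"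
  by (simp add: orthonormal_cols_def)

lemma orthonormal_cols_iff:
  "orthonormal_cols n m X \<longleftrightarrow> X \<in> carrier_mat n m \<and>
     (\<forall>i<m. \<forall>j<m. col X i \<bullet> col X j = (if i = j then 1 else 0))"
proof (cases "X \<in> carrier_mat n m")
  case True
  then have "transpose_mat X * X = 1\<^sub>m m \<longleftrightarrow>
      (\<forall>i<m. \<forall>j<m. col X i \<bullet> col X j = (if i = j then 1 else 0))"
    by (auto simp: mat_eq_iff)
  with True show ?thesis by (simp add: orthonormal_cols_def)
qed (simp add: orthonormal_cols_def)

lemma orthonormal_cols_transpose:
  assumes "orthonormal_cols n n G"
  shows "G * transpose_mat G = 1\<^sub>m n" and "orthonormal_cols n n (transpose_mat G)"
proof -
  show "G * transpose_mat G = 1\<^sub>m n"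
    using assms unfolding orthonormal_cols_def
    by (intro mat_mult_left_right_inverse[of "transpose_mat G" n G]) auto
  then show "orthonormal_cols n n (transpose_mat G)"
    using assms unfolding orthonormal_cols_def by auto
qed

lemma scalar_prod_self_sum: "v \<in> carrier_vec n \<Longrightarrow> v \<bullet> v = (\<Sum>i<n. (v $ i :: real)\<^sup>2)"
  by (auto simp: scalar_prod_def power2_eq_square atLeast0LessThan)

lemma scalar_prod_self_nonneg: "0 \<le> v \<bullet> (v :: real vec)"
  by (subst scalar_prod_self_sum[of v "dim_vec v"]) (auto intro: sum_nonneg)

lemma scalar_prod_self_eq_0: "v \<in> carrier_vec n \<Longrightarrow> v \<bullet> (v :: real vec) = 0 \<longleftrightarrow> v = 0\<^sub>v n"
  by (auto simp: scalar_prod_self_sum sum_nonneg_eq_0_iff intro!: eq_vecI)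

lemma scalar_prod_Cauchy_Schwarz:
  fixes v w :: "real vec"
  assumes "v \<in> carrier_vec n" "w \<in> carrier_vec n"
  shows "(v \<bullet> w)\<^sup>2 \<le> (v \<bullet> v) * (w \<bullet> w)"
  using Cauchy_Schwarz_ineq_sum[of "\<lambda>i. v $ i" "\<lambda>i. w $ i" "{..<n}"] assms
  by (auto simp: scalar_prod_def atLeast0LessThan power2_eq_square)

lemma orthonormal_cols_norm:
  assumes X: "orthonormal_cols n m X" and x: "x \<in> carrier_vec m" and y: "y \<in> carrier_vec m"
  shows "(X *\<^sub>v x) \<bullet> (X *\<^sub>v y) = x \<bullet> y"
proof -
  have c: "X \<in> carrier_mat n m" and o: "transpose_mat X * X = 1\<^sub>m m"
    using X by (auto simp: orthonormal_cols_def)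
  have "(X *\<^sub>v x) \<bullet> (X *\<^sub>v y) = (transpose_mat X *\<^sub>v (X *\<^sub>v x)) \<bullet> y"
    using transpose_vec_mult_scalar[OF c y, of "X *\<^sub>v x"] c x by simp
  also have "transpose_mat X *\<^sub>v (X *\<^sub>v x) = (transpose_mat X * X) *\<^sub>v x"
    using c x by (intro assoc_mult_mat_vec[symmetric]) auto
  finally show ?thesis using x by (simp add: o)
qed

lemma mult_mat_vec_sum_cols:
  assumes "X \<in> carrier_mat n m" "x \<in> carrier_vec m" "i < n"
  shows "(X *\<^sub>v x) $ i = (\<Sum>j<m. X $$ (i, j) * x $ j)"
  using assms by (auto simp: scalar_prod_def atLeast0LessThan)

text \<open>
  The squared norms of the rows of \<open>X\<close> are the diagonal entries of the projection onto its column
  space.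
\<close>

lemma orthonormal_cols_row_sq_le:
  assumes X: "orthonormal_cols n m X" and i: "i < n"
  shows "(\<Sum>j<m. (X $$ (i, j))\<^sup>2) \<le> 1"
proof -
  have c: "X \<in> carrier_mat n m" using X by (rule orthonormal_cols_carrier)
  define x where "x = row X i"
  have x: "x \<in> carrier_vec m" using c unfolding x_def by (rule row_carrier_vec[OF i])
  let ?p = "\<Sum>j<m. (X $$ (i, j))\<^sup>2"
  have p: "?p = x \<bullet> x" using c i by (subst scalar_prod_self_sum[OF x]) (simp add: x_def)
  have "?p = (X *\<^sub>v x) $ i"
    using c i x by (simp add: p x_def)
  then have "?p\<^sup>2 \<le> (\<Sum>k<n. ((X *\<^sub>v x) $ k)\<^sup>2)"
    using i by (auto intro!: member_le_sum[of i "{..<n}" "\<lambda>k. ((X *\<^sub>v x) $ k)\<^sup>2", simplified])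
  also have "\<dots> = (X *\<^sub>v x) \<bullet> (X *\<^sub>v x)"
    using c x by (intro scalar_prod_self_sum[symmetric]) simp
  also have "\<dots> = ?p" using orthonormal_cols_norm[OF X x x] p by simp
  finally have "?p\<^sup>2 \<le> ?p" .
  then show ?thesis
    by (rule_tac ccontr) (simp add: power2_eq_square not_le)
qed

lemma orthonormal_cols_sum_sq:
  assumes X: "orthonormal_cols n m X"
  shows "(\<Sum>i<n. \<Sum>j<m. (X $$ (i, j))\<^sup>2) = real m"
proof -
  have c: "X \<in> carrier_mat n m" using X by (rule orthonormal_cols_carrier)
  have "(\<Sum>i<n. (X $$ (i, j))\<^sup>2) = 1" if "j < m" for j
  proof -
    have "(\<Sum>i<n. (X $$ (i, j))\<^sup>2) = col X j \<bullet> col X j"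
      using c that by (subst scalar_prod_self_sum[of _ n]) auto
    then show ?thesis using X that by (simp add: orthonormal_cols_iff)
  qed
  then show ?thesis by (subst sum.swap) simp
qed

text \<open>Double counting of the squared entries: each of the \<open>m\<close> columns contributes
  exactly 1, each of the \<open>n\<close> rows at most 1.\<close>

lemma orthonormal_cols_le:
  assumes X: "orthonormal_cols n m X"
  shows "m \<le> n"
proof -
  have "real m = (\<Sum>i<n. \<Sum>j<m. (X $$ (i, j))\<^sup>2)" using orthonormal_cols_sum_sq[OF X] by simp
  also have "\<dots> \<le> (\<Sum>i<n. 1)"
    using orthonormal_cols_row_sq_le[OF X] by (intro sum_mono) auto
  finally show ?thesis by simp
qed

text \<open>The rows have squared norms at most 1 with total \<open>m < n\<close>, so some row
  \<open>i\<close> falls short of 1. Then the \<open>i\<close>-th unit vector is not in the column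
  space, and its residual after projection, normalized, is the required vector.\<close>

lemma orthonormal_cols_unit_complement:
  assumes X: "orthonormal_cols n m X" and mn: "m < n"
  shows "\<exists>v\<in>carrier_vec n. v \<bullet> v = 1 \<and> (\<forall>j<m. col X j \<bullet> v = 0)"
proof -
  have c: "X \<in> carrier_mat n m" using X by (rule orthonormal_cols_carrier)
  obtain i where i: "i < n" and lt: "(\<Sum>j<m. (X $$ (i, j))\<^sup>2) < 1"
  proof -
    have "\<exists>i<n. (\<Sum>j<m. (X $$ (i, j))\<^sup>2) < 1"
    proof (rule ccontr)
      assume "\<not> ?thesis"
      then have "(\<Sum>i<n. 1) \<le> (\<Sum>i<n. \<Sum>j<m. (X $$ (i, j))\<^sup>2)"
        by (intro sum_mono) (metis lessThan_iff not_less)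
      then show False using orthonormal_cols_sum_sq[OF X] mn by simp
    qed
    then show thesis using that by blast
  qed
  define x where "x = row X i"
  have x: "x \<in> carrier_vec m" using c unfolding x_def by (rule row_carrier_vec[OF i])
  define u where "u = unit_vec n i - X *\<^sub>v x"
  have u: "u \<in> carrier_vec n" using c x by (simp add: u_def)
  have orth: "col X j \<bullet> u = 0" if "j < m" for j
  proof -
    have unit: "col X j = X *\<^sub>v unit_vec m j"
      using c that by (auto intro!: eq_vecI simp: row_carrier)
    have cj: "col X j \<in> carrier_vec n" using c that by auto
    have "col X j \<bullet> u = col X j \<bullet> unit_vec n i - col X j \<bullet> (X *\<^sub>v x)"
      unfolding u_def using c cj x by (intro scalar_prod_minus_distrib[of _ n]) auto
    also have "col X j \<bullet> unit_vec n i = X $$ (i, j)"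
      using c i that cj by simp
    also have "col X j \<bullet> (X *\<^sub>v x) = X $$ (i, j)"
      unfolding unit
      using orthonormal_cols_norm[OF X unit_vec_carrier x] x c i that by (simp add: x_def)
    finally show ?thesis by simp
  qed
  have "u $ i = 1 - (\<Sum>j<m. (X $$ (i, j))\<^sup>2)"
    using c i x by (simp add: u_def mult_mat_vec_sum_cols x_def power2_eq_square
        scalar_prod_def atLeast0LessThan)
  then have "u \<noteq> 0\<^sub>v n" using lt i by auto
  then have pos: "0 < u \<bullet> u"
    using scalar_prod_self_eq_0[OF u] scalar_prod_self_nonneg[of u] by linarith
  let ?v = "(1 / sqrt (u \<bullet> u)) \<cdot>\<^sub>v u"
  have "?v \<bullet> ?v = 1" using u pos by (simp add: field_simps)
  moreover have "col X j \<bullet> ?v = 0" if "j < m" for j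
    using orth[OF that] c u that by (simp add: scalar_prod_smult_distrib[of _ n])
  ultimately show ?thesis using u by (intro bexI[of _ ?v]) auto
qed

text \<open>Unit vectors are added one at a time, by induction on \<open>m\<close> downwards from
  \<open>n\<close>. Complement bases, eigenbases and rotations are all obtained from such
  completions.\<close>

lemma orthonormal_cols_completion:
  assumes "orthonormal_cols n m X"
  shows "\<exists>G. orthonormal_cols n n G \<and> (\<forall>j<m. col G j = col X j)"
  using orthonormal_cols_le[OF assms] assms
proof (induction m arbitrary: X rule: inc_induct)
  case base
  then show ?case by auto
next
  case (step m)
  have c: "X \<in> carrier_mat n m" using step.prems by (rule orthonormal_cols_carrier)
  obtain v where v: "v \<in> carrier_vec n" "v \<bullet> v = 1" "\<And>j. j < m \<Longrightarrow> col X j \<bullet> v = 0"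
    using orthonormal_cols_unit_complement[OF step.prems] step.hyps by auto
  define Y where "Y = Matrix.mat n (Suc m) (\<lambda>(i, j). if j < m then X $$ (i, j) else v $ i)"
  have colY: "col Y j = (if j < m then col X j else v)" if "j < Suc m" for j
    using that c v by (auto simp: Y_def intro!: eq_vecI)
  have "v \<bullet> col X j = 0" if "j < m" for j
    using v that c comm_scalar_prod[of v n "col X j"] by auto
  then have "orthonormal_cols n (Suc m) Y"
    using step.prems v colY by (auto simp: orthonormal_cols_iff) (auto simp: Y_def)
  from step.IH[OF this] colY show ?case by (metis less_Suc_eq)
qed

subsection \<open>Singular values and the tangent bound\<close>

lemma of_real_poly_prod_list:
  "map_poly complex_of_real (\<Prod>a\<leftarrow>as. [:- a, 1:]) = (\<Prod>a\<leftarrow>map complex_of_real as. [:- a, 1:])"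
proof -
  interpret h: map_poly_inj_idom_hom complex_of_real ..
  show ?thesis by (simp add: h.hom_prod_list o_def)
qed

lemma map_poly_of_real_eq_iff:
  "map_poly complex_of_real p = map_poly complex_of_real q \<longleftrightarrow> p = q"
proof -
  interpret h: map_poly_inj_idom_hom complex_of_real ..
  show ?thesis by (rule h.eq_iff)
qed

lemma proots_prod_list_linear:
  "proots (\<Prod>a\<leftarrow>as. [:- a, 1:] :: real poly) = mset as"
proof (induction as)
  case (Cons a as)
  have "(\<Prod>a\<leftarrow>as. [:- a, 1:] :: real poly) \<noteq> 0"
    by (auto simp: prod_list_zero_iff)
  then show ?case using Cons by (simp add: proots_mult del: mult_pCons_left)
qed simp

lemma char_poly_of_real:
  "N \<in> carrier_mat n n \<Longrightarrow>
    char_poly (map_mat complex_of_real N) = map_poly complex_of_real (char_poly N)"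
  by (rule of_real_hom.char_poly_hom)

text \<open>At a complex eigenvector the Hermitian form \<open>?s\<close> is \<open>z\<close> times
  the squared norm, while symmetry of \<open>N\<close> makes \<open>?s\<close> its own
  conjugate.\<close>

lemma real_symmetric_eigenvalue_real:
  fixes N :: "real mat"
  assumes N: "N \<in> carrier_mat n n" and sym: "transpose_mat N = N"
    and root: "poly (map_poly complex_of_real (char_poly N)) z = 0"
  shows "z \<in> \<real>"
proof -
  let ?N = "map_mat complex_of_real N"
  have cN: "?N \<in> carrier_mat n n" using N by simp
  have "eigenvalue ?N z"
    using root by (simp add: char_poly_of_real[OF N] eigenvalue_root_char_poly[OF cN])
  then obtain v where v: "v \<in> carrier_vec n" "v \<noteq> 0\<^sub>v n" and ev: "?N *\<^sub>v v = z \<cdot>\<^sub>v v"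
    using cN unfolding eigenvalue_def eigenvector_def by auto
  have Nv: "(\<Sum>j<n. of_real (N $$ (i, j)) * v $ j) = z * v $ i" if "i < n" for i
    using arg_cong[OF ev, of "\<lambda>u. u $ i"] that v N
    by (simp add: scalar_prod_def atLeast0LessThan)
  have symN: "N $$ (i, j) = N $$ (j, i)" if "i < n" "j < n" for i j
    using arg_cong[OF sym, of "\<lambda>X. X $$ (i, j)"] that N by simp
  let ?s = "\<Sum>i<n. \<Sum>j<n. cnj (v $ i) * of_real (N $$ (i, j)) * v $ j"
  have s: "?s = z * (\<Sum>i<n. of_real ((cmod (v $ i))\<^sup>2))"
  proof -
    have "?s = (\<Sum>i<n. cnj (v $ i) * (\<Sum>j<n. of_real (N $$ (i, j)) * v $ j))"
      by (simp add: sum_distrib_left mult.assoc)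
    also have "\<dots> = (\<Sum>i<n. z * of_real ((cmod (v $ i))\<^sup>2))"
      by (intro sum.cong refl, subst Nv) (simp_all add: complex_norm_square mult_ac del: of_real_power)
    finally show ?thesis by (simp add: sum_distrib_left)
  qed
  have "cnj ?s = (\<Sum>i<n. \<Sum>j<n. v $ i * of_real (N $$ (i, j)) * cnj (v $ j))"
    by simp
  also have "\<dots> = (\<Sum>j<n. \<Sum>i<n. v $ i * of_real (N $$ (i, j)) * cnj (v $ j))"
    by (rule sum.swap)
  also have "\<dots> = ?s"
    by (intro sum.cong refl) (use symN in \<open>auto simp: mult_ac\<close>)
  finally have "cnj ?s = ?s" .
  then have "cnj z * (\<Sum>i<n. of_real ((cmod (v $ i))\<^sup>2)) = z * (\<Sum>i<n. of_real ((cmod (v $ i))\<^sup>2))"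
    unfolding s by simp
  moreover have "(\<Sum>i<n. complex_of_real ((cmod (v $ i))\<^sup>2)) \<noteq> 0"
  proof
    assume "(\<Sum>i<n. complex_of_real ((cmod (v $ i))\<^sup>2)) = 0"
    then have "(\<Sum>i<n. (cmod (v $ i))\<^sup>2) = 0"
      by (metis of_real_eq_0_iff of_real_sum)
    then have "v $ i = 0" if "i < n" for i
      using that by (simp add: sum_nonneg_eq_0_iff)
    then show False using v by (auto intro!: eq_vecI)
  qed
  ultimately have "cnj z = z" by (metis mult_right_cancel)
  then show ?thesis by (simp add: Reals_cnj_iff)
qed

text \<open>\<open>proots\<close> counts real roots only, so a full count needs the complex
  factorization to descend to the reals; it does because all its roots are real. This gives
  \<open>singular_values\<close> its full length.\<close>

lemma real_symmetric_size_proots: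
  fixes N :: "real mat"
  assumes N: "N \<in> carrier_mat n n" and sym: "transpose_mat N = N"
  shows "size (proots (char_poly N)) = n"
proof -
  have cN: "map_mat complex_of_real N \<in> carrier_mat n n" using N by simp
  obtain as where as: "map_poly complex_of_real (char_poly N) = (\<Prod>a\<leftarrow>as. [:- a, 1:])"
    and len: "length as = n"
    using char_poly_factorized[OF cN] char_poly_of_real[OF N] by metis
  have "a \<in> \<real>" if "a \<in> set as" for a
  proof (rule real_symmetric_eigenvalue_real[OF N sym])
    show "poly (map_poly complex_of_real (char_poly N)) a = 0"
      using that unfolding as by (auto simp: poly_prod_list prod_list_zero_iff)
  qed
  then have "map complex_of_real (map Re as) = as"
    by (auto intro!: map_idI)
  then have "map_poly complex_of_real (char_poly N)
      = map_poly complex_of_real (\<Prod>a\<leftarrow>map Re as. [:- a, 1:])"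
    unfolding as of_real_poly_prod_list by simp
  then have "char_poly N = (\<Prod>a\<leftarrow>map Re as. [:- a, 1:])"
    by (rule map_poly_of_real_eq_iff[THEN iffD1])
  then show ?thesis unfolding proots_prod_list_linear by (simp only: proots_prod_list_linear size_mset length_map len)
qed

lemma length_singular_values: "length (singular_values X) = dim_col X"
proof -
  have "size (proots (char_poly (transpose_mat X * X))) = dim_col X"
    by (rule real_symmetric_size_proots) (auto simp: transpose_mult[of _ "dim_col X" "dim_row X" _ "dim_col X"])
  moreover have "length (sorted_list_of_multiset M) = size M" for M :: "real multiset"
    by (metis mset_sorted_list_of_multiset size_mset)
  ultimately show ?thesis by (simp add: singular_values_def)
qed

text \<open>An eigenvector of \<open>transpose_mat X * X\<close> attains the value. This replaces a
  min-max principle: the later estimates hold for all vectors, so evaluating them at one attaining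
  vector suffices.\<close>

lemma sigma_attained:
  assumes X: "X \<in> carrier_mat n m" and p: "1 \<le> p" "p \<le> m"
  shows "\<exists>y\<in>carrier_vec m. y \<noteq> 0\<^sub>v m \<and> (X *\<^sub>v y) \<bullet> (X *\<^sub>v y) = (sigma p X)\<^sup>2 * (y \<bullet> y)
    \<and> 0 \<le> sigma p X"
proof -
  let ?N = "transpose_mat X * X"
  have N: "?N \<in> carrier_mat m m" using X by simp
  have len: "p \<le> length (singular_values X)" using X p by (simp add: length_singular_values)
  then have "sigma p X \<in> set (singular_values X)"
    using p by (auto simp: sigma_def)
  then obtain e where e: "e \<in># proots (char_poly ?N)" and se: "sigma p X = sqrt e"
    unfolding singular_values_def by auto
  have "char_poly ?N \<noteq> 0" using degree_monic_char_poly[OF N] by auto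
  with e have "poly (char_poly ?N) e = 0" by simp
  then obtain y where y: "y \<in> carrier_vec m" "y \<noteq> 0\<^sub>v m" and ev: "?N *\<^sub>v y = e \<cdot>\<^sub>v y"
    using eigenvalue_root_char_poly[OF N] N unfolding eigenvalue_def eigenvector_def by (metis carrier_matD(1))
  have "(X *\<^sub>v y) \<bullet> (X *\<^sub>v y) = (transpose_mat X *\<^sub>v (X *\<^sub>v y)) \<bullet> y"
    using transpose_vec_mult_scalar[OF X y(1), of "X *\<^sub>v y"] X y by simp
  also have "transpose_mat X *\<^sub>v (X *\<^sub>v y) = ?N *\<^sub>v y"
    using X y by (intro assoc_mult_mat_vec[symmetric]) auto
  finally have eq: "(X *\<^sub>v y) \<bullet> (X *\<^sub>v y) = e * (y \<bullet> y)" using y by (simp add: ev)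
  have "0 < y \<bullet> y"
    using y scalar_prod_self_eq_0[OF y(1)] scalar_prod_self_nonneg[of y] by linarith
  then have "0 \<le> e" using eq scalar_prod_self_nonneg[of "X *\<^sub>v y"] by (simp add: zero_le_mult_iff)
  then show ?thesis using y eq se by auto
qed

text \<open>The last \<open>n - m\<close> columns of an orthogonal completion of \<open>Y\<close>
  serve as the basis. Existence is what makes the choice in \<open>subspace_tan\<close> a genuine
  complement.\<close>

lemma is_complement_basis_exists:
  assumes Y: "orthonormal_cols n m Y"
  shows "\<exists>N. is_complement_basis Y N"
proof -
  obtain G where G: "orthonormal_cols n n G" and GY: "\<And>j. j < m \<Longrightarrow> col G j = col Y j"
    using orthonormal_cols_completion[OF Y] by auto
  have cY: "Y \<in> carrier_mat n m" and cG: "G \<in> carrier_mat n n"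
    using Y G by (auto simp: orthonormal_cols_def)
  have mn: "m \<le> n" using orthonormal_cols_le[OF Y] .
  define N where "N = Matrix.mat n (n - m) (\<lambda>(i, j). G $$ (i, m + j))"
  have cN: "N \<in> carrier_mat n (n - m)" by (simp add: N_def)
  have colN: "col N j = col G (m + j)" if "j < n - m" for j
    using that cG by (auto simp: N_def intro!: eq_vecI)
  have oN: "orthonormal_cols n (n - m) N"
    using G colN cN unfolding orthonormal_cols_iff by auto
  have orthYN: "col Y i \<bullet> col N j = 0" if "i < m" "j < n - m" for i j
  proof -
    have "col Y i \<bullet> col N j = col G i \<bullet> col G (m + j)"
      using that by (simp add: colN GY)
    also have "\<dots> = 0" using G that by (simp add: orthonormal_cols_iff)
    finally show ?thesis .
  qed
  have tYN: "transpose_mat Y * N = 0\<^sub>m m (n - m)"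
    using cY cN orthYN by (intro eq_matI) auto
  have "col_space N = {v \<in> carrier_vec n. \<forall>x\<in>col_space Y. x \<bullet> v = 0}"
  proof (intro equalityI subsetI)
    fix v assume "v \<in> col_space N"
    then obtain y where y: "y \<in> carrier_vec (n - m)" and v: "v = N *\<^sub>v y"
      using cN by (auto simp: col_space_def)
    have "(Y *\<^sub>v x) \<bullet> v = 0" if x: "x \<in> carrier_vec m" for x
    proof -
      have "transpose_mat Y *\<^sub>v v = (transpose_mat Y * N) *\<^sub>v y"
        unfolding v using cY cN y by (intro assoc_mult_mat_vec[symmetric]) auto
      also have "\<dots> = 0\<^sub>v m" unfolding tYN using y by (auto intro!: eq_vecI)
      finally have "(transpose_mat Y *\<^sub>v v) \<bullet> x = 0" using x by simp
      moreover have "(transpose_mat Y *\<^sub>v v) \<bullet> x = v \<bullet> (Y *\<^sub>v x)"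
        using transpose_vec_mult_scalar[OF cY x, of v] v cN y by simp
      ultimately show ?thesis
        using comm_scalar_prod[of v n "Y *\<^sub>v x"] v cN cY y x by simp
    qed
    then show "v \<in> {v \<in> carrier_vec n. \<forall>x\<in>col_space Y. x \<bullet> v = 0}"
      using v cN cY y by (auto simp: col_space_def)
  next
    fix v assume "v \<in> {v \<in> carrier_vec n. \<forall>x\<in>col_space Y. x \<bullet> v = 0}"
    then have v: "v \<in> carrier_vec n" and orth: "\<And>x. x \<in> carrier_vec m \<Longrightarrow> (Y *\<^sub>v x) \<bullet> v = 0"
      using cY by (auto simp: col_space_def)
    have zero: "col G j \<bullet> v = 0" if "j < m" for j
    proof -
      have "col G j = Y *\<^sub>v unit_vec m j"
        using cY that GY[OF that] by (auto intro!: eq_vecI)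
      then show ?thesis using orth[of "unit_vec m j"] by simp
    qed
    define y where "y = transpose_mat N *\<^sub>v v"
    have y: "y \<in> carrier_vec (n - m)" using cN v by (simp add: y_def)
    \<comment> \<open>\<open>v\<close> is expanded in the orthonormal basis \<open>G\<close>;
      orthogonality to \<open>Y\<close> removes the first \<open>m\<close> coefficients, so only the
      columns of \<open>N\<close> remain.\<close>
    have "v = (G * transpose_mat G) *\<^sub>v v"
      using orthonormal_cols_transpose(1)[OF G] v by simp
    also have "\<dots> = G *\<^sub>v (transpose_mat G *\<^sub>v v)"
      using cG v by (intro assoc_mult_mat_vec) auto
    also have "\<dots> = N *\<^sub>v y"
    proof (rule eq_vecI)
      fix i assume "i < dim_vec (N *\<^sub>v y)"
      then have i: "i < n" using cN by simp
      have "(G *\<^sub>v (transpose_mat G *\<^sub>v v)) $ i = (\<Sum>j<n. G $$ (i, j) * (col G j \<bullet> v))"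
        using cG v i by (subst mult_mat_vec_sum_cols[OF cG]) auto
      also have "\<dots> = (\<Sum>j\<in>{m..<n}. G $$ (i, j) * (col G j \<bullet> v))"
        using zero by (intro sum.mono_neutral_right) (auto simp: not_le)
      also have "\<dots> = (\<Sum>j<n - m. G $$ (i, m + j) * (col G (m + j) \<bullet> v))"
        using mn by (intro sum.reindex_bij_witness[of _ "\<lambda>j. m + j" "\<lambda>j. j - m"]) auto
      also have "\<dots> = (N *\<^sub>v y) $ i"
        using cN y i colN by (subst mult_mat_vec_sum_cols[OF cN]) (auto simp: y_def, auto simp: N_def)
      finally show "(G *\<^sub>v (transpose_mat G *\<^sub>v v)) $ i = (N *\<^sub>v y) $ i" .
    qed (use cN cG in auto)
    finally show "v \<in> col_space N" using y cN by (auto simp: col_space_def)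
  qed
  then show ?thesis
    using oN cN cY unfolding is_complement_basis_def by (intro exI[of _ N]) auto
qed

section \<open>The tangent from a quadratic inequality\<close>

lemma vec_minus_scalar_prod:
  fixes a b c e :: "real vec"
  assumes "a \<in> carrier_vec n" "b \<in> carrier_vec n" "c \<in> carrier_vec n" "e \<in> carrier_vec n"
  shows "(a - b) \<bullet> (c - e) = a \<bullet> c - a \<bullet> e - b \<bullet> c + b \<bullet> e"
  using assms by (simp add: minus_scalar_prod_distrib[of _ n] scalar_prod_minus_distrib[of _ n])

text \<open>
  With \<open>u = U\<^sup>T z\<close> for a unit vector \<open>z\<close> orthogonal to the columns of \<open>Q\<close>, and \<open>x\<close> such that
  \<open>U\<^sup>T Q x = u\<close>, the components of \<open>z\<close> and \<open>Q x\<close> orthogonal to \<open>U\<close> have inner product \<open>- (u \<bullet> u)\<close>.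
\<close>

lemma subspace_tan_le:
  assumes U: "orthonormal_cols n r U" and Q: "orthonormal_cols n r Q" and r: "1 \<le> r"
    and eps: "0 \<le> \<epsilon>"
    and le: "\<And>x. x \<in> carrier_vec r \<Longrightarrow>
      x \<bullet> x \<le> (1 + \<epsilon>\<^sup>2) * ((transpose_mat U *\<^sub>v (Q *\<^sub>v x)) \<bullet> (transpose_mat U *\<^sub>v (Q *\<^sub>v x)))"
  shows "subspace_tan U Q \<le> ereal \<epsilon>"
proof -
  define W where "W = transpose_mat U * Q"
  define N where "N = (SOME N. is_complement_basis Q N)"
  define s where "s = sigma_min W"
  define t where "t = sigma_max (transpose_mat U * N)"
  have cU: "U \<in> carrier_mat n r" and cQ: "Q \<in> carrier_mat n r"
    using U Q by (auto simp: orthonormal_cols_def)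
  have cW: "W \<in> carrier_mat r r" using cU cQ by (simp add: W_def)
  have Wx: "W *\<^sub>v x = transpose_mat U *\<^sub>v (Q *\<^sub>v x)" if "x \<in> carrier_vec r" for x
    unfolding W_def using cU cQ that by (intro assoc_mult_mat_vec) auto
  have leW: "x \<bullet> x \<le> (1 + \<epsilon>\<^sup>2) * ((W *\<^sub>v x) \<bullet> (W *\<^sub>v x))" if "x \<in> carrier_vec r" for x
    using le[OF that] Wx[OF that] by simp
  have e1: "0 < 1 + \<epsilon>\<^sup>2" by (simp add: add_pos_nonneg)
  \<comment> \<open>The vector attaining the least singular value turns the hypothesis into a lower
    bound on the cosine \<open>s\<close>.\<close>
  have ssq: "1 \<le> (1 + \<epsilon>\<^sup>2) * s\<^sup>2" and s0: "0 \<le> s"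
  proof -
    have "s = sigma r W" using cW by (simp add: s_def sigma_min_def)
    then obtain y where y: "y \<in> carrier_vec r" "y \<noteq> 0\<^sub>v r"
      and yy: "(W *\<^sub>v y) \<bullet> (W *\<^sub>v y) = s\<^sup>2 * (y \<bullet> y)" and s0: "0 \<le> s"
      using sigma_attained[OF cW r order.refl] by auto
    have "0 < y \<bullet> y"
      using y scalar_prod_self_eq_0[OF y(1)] scalar_prod_self_nonneg[of y] by linarith
    moreover have "1 * (y \<bullet> y) \<le> ((1 + \<epsilon>\<^sup>2) * s\<^sup>2) * (y \<bullet> y)"
      using leW[OF y(1)] yy by (simp add: mult.assoc)
    ultimately show "1 \<le> (1 + \<epsilon>\<^sup>2) * s\<^sup>2" by (rule mult_right_le_imp_le[rotated])
    show "0 \<le> s" by fact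
  qed
  have spos: "0 < s" using ssq s0 by (cases "s = 0") auto
  have comp: "is_complement_basis Q N"
    unfolding N_def using is_complement_basis_exists[OF Q] by (rule someI_ex)
  define m where "m = dim_col N"
  have oN: "orthonormal_cols n m N"
    using comp cQ unfolding is_complement_basis_def m_def by auto
  have cN: "N \<in> carrier_mat n m" using oN by (rule orthonormal_cols_carrier)
  have "t\<^sup>2 * (1 + \<epsilon>\<^sup>2) \<le> \<epsilon>\<^sup>2 \<and> 0 \<le> t"
  proof (cases "m = 0")
    \<comment> \<open>A complement without columns occurs when \<open>Q\<close> is square;
      \<open>sigma\<close> past the end of its list is 0, hence \<open>t = 0\<close>.\<close>
    case True
    then have "t = 0" using cN by (simp add: t_def sigma_max_def sigma_def length_singular_values)
    then show ?thesis by simp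
  next
    case False
    have cUN: "transpose_mat U * N \<in> carrier_mat r m" using cU cN by simp
    obtain y where y: "y \<in> carrier_vec m" "y \<noteq> 0\<^sub>v m" and t0: "0 \<le> t"
      and yy: "((transpose_mat U * N) *\<^sub>v y) \<bullet> ((transpose_mat U * N) *\<^sub>v y) = t\<^sup>2 * (y \<bullet> y)"
      using sigma_attained[OF cUN order.refl] False unfolding t_def sigma_max_def by auto
    have ypos: "0 < y \<bullet> y"
      using y scalar_prod_self_eq_0[OF y(1)] scalar_prod_self_nonneg[of y] by linarith
    define z where "z = N *\<^sub>v y"
    define u where "u = transpose_mat U *\<^sub>v z"
    have z: "z \<in> carrier_vec n" and u: "u \<in> carrier_vec r"
      using cN cU y by (simp_all add: z_def u_def)
    have uu: "u \<bullet> u = t\<^sup>2 * (y \<bullet> y)"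
      using yy cU cN y by (simp add: u_def z_def assoc_mult_mat_vec[of _ r n _ m])
    have zz: "z \<bullet> z = y \<bullet> y" unfolding z_def by (rule orthonormal_cols_norm[OF oN y(1) y(1)])
    have Qz: "(Q *\<^sub>v x) \<bullet> z = 0" if "x \<in> carrier_vec r" for x
    proof -
      have "z \<in> col_space N" using y cN by (auto simp: col_space_def z_def)
      then show ?thesis
        using comp that cQ unfolding is_complement_basis_def by (auto simp: col_space_def)
    qed
    have "det W \<noteq> 0"
    proof
      assume "det W = 0"
      then obtain x where x: "x \<in> carrier_vec r" "x \<noteq> 0\<^sub>v r" "W *\<^sub>v x = 0\<^sub>v r"
        using det_0_iff_vec_prod_zero[OF cW] by auto
      then show False
        using leW[OF x(1)] scalar_prod_self_eq_0[OF x(1)] scalar_prod_self_nonneg[of x] by auto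
    qed
    then obtain V where V: "V \<in> carrier_mat r r" "W * V = 1\<^sub>m r"
      using det_non_zero_imp_unit[OF cW] by (auto simp: Units_def ring_mat_simps)
    define x where "x = V *\<^sub>v u"
    have x: "x \<in> carrier_vec r" using V u by (simp add: x_def)
    have "W *\<^sub>v x = (W * V) *\<^sub>v u"
      unfolding x_def using V u cW by (intro assoc_mult_mat_vec[symmetric]) auto
    then have WxU: "W *\<^sub>v x = u" using V u by simp
    have Ux: "transpose_mat U *\<^sub>v (Q *\<^sub>v x) = u" using Wx[OF x] WxU by simp
    have Uu: "(U *\<^sub>v u) \<bullet> (U *\<^sub>v u) = u \<bullet> u" by (rule orthonormal_cols_norm[OF U u u])
    have adj: "w \<bullet> (U *\<^sub>v u) = (transpose_mat U *\<^sub>v w) \<bullet> u" if "w \<in> carrier_vec n" for w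
      using transpose_vec_mult_scalar[OF cU u that] by simp
    have comm: "(U *\<^sub>v u) \<bullet> w = w \<bullet> (U *\<^sub>v u)" if "w \<in> carrier_vec n" for w
      using comm_scalar_prod[of w n "U *\<^sub>v u"] that cU u by simp
    have Uv: "U *\<^sub>v u \<in> carrier_vec n" and Qx: "Q *\<^sub>v x \<in> carrier_vec n"
      using cU cQ u x by simp_all
    have 1: "(z - U *\<^sub>v u) \<bullet> (Q *\<^sub>v x - U *\<^sub>v u) = - (u \<bullet> u)"
      using Qz[OF x] comm_scalar_prod[OF Qx z]
      by (simp add: vec_minus_scalar_prod[OF z Uv Qx Uv] comm[OF Qx] adj[OF z] adj[OF Qx] Ux Uu u_def[symmetric])
    have 2: "(z - U *\<^sub>v u) \<bullet> (z - U *\<^sub>v u) = y \<bullet> y - u \<bullet> u"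
      by (simp add: vec_minus_scalar_prod[OF z Uv z Uv] comm[OF z] adj[OF z] Uu zz u_def[symmetric])
    have 3: "(Q *\<^sub>v x - U *\<^sub>v u) \<bullet> (Q *\<^sub>v x - U *\<^sub>v u) = x \<bullet> x - u \<bullet> u"
      by (simp add: vec_minus_scalar_prod[OF Qx Uv Qx Uv] comm[OF Qx] adj[OF Qx] Ux Uu
          orthonormal_cols_norm[OF Q x x])
    \<comment> \<open>Cauchy-Schwarz for the two components orthogonal to \<open>U\<close>, whose
      squared norms were just computed. The hypothesis bounds the second by
      \<open>\<epsilon>\<^sup>2 * (u \<bullet> u)\<close>, and one factor
      \<open>u \<bullet> u\<close> then cancels.\<close>
    have "(u \<bullet> u)\<^sup>2 \<le> (y \<bullet> y - u \<bullet> u) * (x \<bullet> x - u \<bullet> u)"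
      using scalar_prod_Cauchy_Schwarz[of "z - U *\<^sub>v u" n "Q *\<^sub>v x - U *\<^sub>v u"] z Uv Qx
      unfolding 1 2 3 by simp
    also have "\<dots> \<le> (y \<bullet> y - u \<bullet> u) * (\<epsilon>\<^sup>2 * (u \<bullet> u))"
    proof (rule mult_left_mono)
      show "x \<bullet> x - u \<bullet> u \<le> \<epsilon>\<^sup>2 * (u \<bullet> u)" using leW[OF x] WxU by (simp add: algebra_simps)
      show "0 \<le> y \<bullet> y - u \<bullet> u" unfolding 2[symmetric] by (rule scalar_prod_self_nonneg)
    qed
    finally have *: "(u \<bullet> u) * (u \<bullet> u) \<le> ((y \<bullet> y - u \<bullet> u) * \<epsilon>\<^sup>2) * (u \<bullet> u)"
      by (simp add: power2_eq_square mult_ac)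
    have "u \<bullet> u \<le> (y \<bullet> y - u \<bullet> u) * \<epsilon>\<^sup>2"
    proof (cases "u \<bullet> u = 0")
      case True
      then show ?thesis using ypos by simp
    next
      case False
      then have "0 < u \<bullet> u" using scalar_prod_self_nonneg[of u] by linarith
      with * show ?thesis by (rule mult_right_le_imp_le)
    qed
    then have "(t\<^sup>2 * (1 + \<epsilon>\<^sup>2)) * (y \<bullet> y) \<le> \<epsilon>\<^sup>2 * (y \<bullet> y)"
      unfolding uu by (simp add: algebra_simps)
    then have "t\<^sup>2 * (1 + \<epsilon>\<^sup>2) \<le> \<epsilon>\<^sup>2" by (rule mult_right_le_imp_le[OF _ ypos])
    with t0 show ?thesis by blast
  qed
  then have t: "t\<^sup>2 * (1 + \<epsilon>\<^sup>2) \<le> \<epsilon>\<^sup>2" and t0: "0 \<le> t" by auto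
  \<comment> \<open>The sine satisfies \<open>t\<^sup>2 \<le> \<epsilon>\<^sup>2 / (1 +
    \<epsilon>\<^sup>2)\<close> and the cosine
    \<open>s\<^sup>2 \<ge> 1 / (1 + \<epsilon>\<^sup>2)\<close>, so the common factor drops out of
    the quotient.\<close>
  have "t\<^sup>2 * (1 + \<epsilon>\<^sup>2) \<le> (\<epsilon>\<^sup>2 * s\<^sup>2) * (1 + \<epsilon>\<^sup>2)"
  proof -
    have "\<epsilon>\<^sup>2 * 1 \<le> \<epsilon>\<^sup>2 * ((1 + \<epsilon>\<^sup>2) * s\<^sup>2)" using ssq by (intro mult_left_mono) auto
    with t show ?thesis by (simp add: mult_ac)
  qed
  then have "t\<^sup>2 \<le> (\<epsilon> * s)\<^sup>2"
    unfolding power_mult_distrib by (rule mult_right_le_imp_le[OF _ e1])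
  then have "t \<le> \<epsilon> * s" using eps s0 by (rule power2_le_imp_le[OF _ mult_nonneg_nonneg])
  then have "t / s \<le> \<epsilon>" using spos by (simp add: divide_le_eq)
  then show ?thesis
    using spos unfolding subspace_tan_def Let_def N_def[symmetric] W_def[symmetric] s_def[symmetric] t_def[symmetric]
    by simp
qed

subsection \<open>Matrices diagonalized by an orthonormal basis\<close>

lemma first_cols_carrier:
  "X \<in> carrier_mat n m \<Longrightarrow> r \<le> m \<Longrightarrow> first_cols X r \<in> carrier_mat n r"
  by (auto simp: first_cols_def)

lemma col_first_cols:
  assumes "X \<in> carrier_mat n m" "r \<le> m" "j < r"
  shows "col (first_cols X r) j = col X j"
proof -
  have "col (first_cols X r) j = take r (cols X) ! j"
    unfolding first_cols_def using assms by (intro col_mat_of_cols) auto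
  then show ?thesis using assms by simp
qed

lemma orthonormal_first_cols:
  "orthonormal_cols n m X \<Longrightarrow> r \<le> m \<Longrightarrow> orthonormal_cols n r (first_cols X r)"
  unfolding orthonormal_cols_iff using first_cols_carrier col_first_cols by fastforce

lemma transpose_mult_vec_norm:
  fixes X :: "real mat"
  assumes "X \<in> carrier_mat n m"
  shows "(transpose_mat X *\<^sub>v v) \<bullet> (transpose_mat X *\<^sub>v v) = (\<Sum>j<m. (col X j \<bullet> v)\<^sup>2)"
  using assms by (subst scalar_prod_self_sum[of _ m]) (auto intro!: carrier_vecI)

lemma orthonormal_cols_parseval:
  assumes G: "orthonormal_cols n n G" and v: "v \<in> carrier_vec n"
  shows "v \<bullet> v = (\<Sum>j<n. (col G j \<bullet> v)\<^sup>2)"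
proof -
  have cG: "G \<in> carrier_mat n n" using G by (rule orthonormal_cols_carrier)
  have "(transpose_mat G *\<^sub>v v) \<bullet> (transpose_mat G *\<^sub>v v) = v \<bullet> v"
    using orthonormal_cols_norm[OF orthonormal_cols_transpose(2)[OF G] v v] .
  then show ?thesis using transpose_mult_vec_norm[OF cG, of v] by simp
qed

lemma orthonormal_cols_eqI:
  assumes G: "orthonormal_cols n n G" and v: "v \<in> carrier_vec n" and w: "w \<in> carrier_vec n"
    and eq: "\<And>j. j < n \<Longrightarrow> col G j \<bullet> v = col G j \<bullet> w"
  shows "v = w"
proof -
  have cG: "G \<in> carrier_mat n n" using G by (rule orthonormal_cols_carrier)
  have *: "G *\<^sub>v (transpose_mat G *\<^sub>v u) = u" if "u \<in> carrier_vec n" for u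
    using assoc_mult_mat_vec[of G n n "transpose_mat G" n u] cG that orthonormal_cols_transpose(1)[OF G]
    by simp
  have "transpose_mat G *\<^sub>v v = transpose_mat G *\<^sub>v w"
    using cG eq by (intro eq_vecI) auto
  then show ?thesis using *[OF v] *[OF w] by metis
qed

text \<open>\<open>K\<close> is the squared Frobenius norm, by Cauchy-Schwarz in each row.\<close>

lemma mult_mat_vec_bounded:
  fixes B :: "real mat"
  assumes B: "B \<in> carrier_mat n m"
  shows "\<exists>K\<ge>0. \<forall>x\<in>carrier_vec m. (B *\<^sub>v x) \<bullet> (B *\<^sub>v x) \<le> K * (x \<bullet> x)"
proof (intro exI conjI ballI)
  show "0 \<le> (\<Sum>i<n. row B i \<bullet> row B i)"
    by (intro sum_nonneg scalar_prod_self_nonneg)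
  fix x :: "real vec" assume x: "x \<in> carrier_vec m"
  have "(B *\<^sub>v x) \<bullet> (B *\<^sub>v x) = (\<Sum>i<n. (row B i \<bullet> x)\<^sup>2)"
    using B by (subst scalar_prod_self_sum[of _ n]) (auto intro!: carrier_vecI)
  also have "\<dots> \<le> (\<Sum>i<n. (row B i \<bullet> row B i) * (x \<bullet> x))"
    using B x by (intro sum_mono scalar_prod_Cauchy_Schwarz[of _ m]) auto
  finally show "(B *\<^sub>v x) \<bullet> (B *\<^sub>v x) \<le> (\<Sum>i<n. row B i \<bullet> row B i) * (x \<bullet> x)"
    by (simp add: sum_distrib_right)
qed

lemma diagonalized_carrier:
  "G \<in> carrier_mat n n \<Longrightarrow> G * mat_diag n e * transpose_mat G \<in> carrier_mat n n"
  by (auto intro!: mult_carrier_mat[of _ n n])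

lemma diagonalized_char_poly:
  assumes G: "orthonormal_cols n n G"
  shows "char_poly (G * mat_diag n e * transpose_mat G) = (\<Prod>a\<leftarrow>map e [0..<n]. [:- a, 1:])"
proof -
  have cG: "G \<in> carrier_mat n n" using G by (rule orthonormal_cols_carrier)
  have "similar_mat (G * mat_diag n e * transpose_mat G) (mat_diag n e)"
    using G cG orthonormal_cols_transpose(1)[OF G]
    by (intro similar_matI[of _ _ G "transpose_mat G" n]) (auto simp: orthonormal_cols_def)
  then have "char_poly (G * mat_diag n e * transpose_mat G) = char_poly (mat_diag n e)"
    by (rule char_poly_similar)
  also have "\<dots> = (\<Prod>a\<leftarrow>diag_mat (mat_diag n e). [:- a, 1:])"
    by (rule char_poly_upper_triangular[of _ n]) (auto simp: mat_diag_def)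
  also have "diag_mat (mat_diag n e) = map e [0..<n]"
    by (auto simp: diag_mat_def mat_diag_def)
  finally show ?thesis .
qed

lemma diagonalized_coord:
  assumes G: "orthonormal_cols n n G" and v: "v \<in> carrier_vec n" and i: "i < n"
  shows "col G i \<bullet> ((G * mat_diag n e * transpose_mat G) *\<^sub>v v) = e i * (col G i \<bullet> v)"
proof -
  have cG: "G \<in> carrier_mat n n" and o: "transpose_mat G * G = 1\<^sub>m n"
    using G by (auto simp: orthonormal_cols_def)
  define w where "w = transpose_mat G *\<^sub>v v"
  have w: "w \<in> carrier_vec n" using cG v by (simp add: w_def)
  have Dw: "mat_diag n e *\<^sub>v w \<in> carrier_vec n" by (intro carrier_vecI) (simp add: mat_diag_def)
  have "(G * mat_diag n e * transpose_mat G) *\<^sub>v v = G *\<^sub>v (mat_diag n e *\<^sub>v w)"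
    unfolding w_def using cG v
    by (simp add: assoc_mult_mat_vec[of _ n n _ n])
  then have "transpose_mat G *\<^sub>v ((G * mat_diag n e * transpose_mat G) *\<^sub>v v)
      = (transpose_mat G * G) *\<^sub>v (mat_diag n e *\<^sub>v w)"
    using cG w Dw by (simp add: assoc_mult_mat_vec[of _ n n _ n])
  also have "\<dots> = mat_diag n e *\<^sub>v w" using Dw by (simp add: o)
  finally have "(transpose_mat G *\<^sub>v ((G * mat_diag n e * transpose_mat G) *\<^sub>v v)) $ i
      = (mat_diag n e *\<^sub>v w) $ i" by simp
  moreover have "(mat_diag n e *\<^sub>v w) $ i = e i * w $ i"
    using w i by (subst mult_mat_vec_sum_cols[of _ n n])
      (simp_all add: mat_diag_def if_distrib[of "\<lambda>x. x * _"] sum.delta' cong: if_cong)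
  ultimately show ?thesis using cG i by (simp add: w_def)
qed

text \<open>\<open>transpose_mat ?M * ?M\<close> is diagonal in the same basis with entries
  \<open>(e i)\<^sup>2\<close>, and nonnegativity of \<open>e\<close> lets \<open>sqrt\<close>
  return \<open>e i\<close>.\<close>

lemma diagonalized_singular_values:
  assumes G: "orthonormal_cols n n G" and nonneg: "\<And>i. i < n \<Longrightarrow> 0 \<le> e i"
    and decr: "\<And>i j. i \<le> j \<Longrightarrow> j < n \<Longrightarrow> e j \<le> e i"
  shows "singular_values (G * mat_diag n e * transpose_mat G) = map e [0..<n]"
proof -
  let ?M = "G * mat_diag n e * transpose_mat G" and ?D = "mat_diag n e"
  have cG: "G \<in> carrier_mat n n" and o: "transpose_mat G * G = 1\<^sub>m n"
    using G by (auto simp: orthonormal_cols_def)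
  have cD: "?D \<in> carrier_mat n n" and cT: "transpose_mat G \<in> carrier_mat n n" using cG by simp_all
  have cDT: "?D * transpose_mat G \<in> carrier_mat n n" and cGD: "G * ?D \<in> carrier_mat n n"
    using cG cT cD by (auto intro!: mult_carrier_mat[of _ n n])
  have tD: "transpose_mat ?D = ?D" by (intro eq_matI) (auto simp: mat_diag_def)
  have "transpose_mat ?M = G * (?D * transpose_mat G)"
    using cG cD cT cGD by (simp add: transpose_mult[of _ n n _ n] tD)
  then have "transpose_mat ?M * ?M = G * (?D * transpose_mat G) * (G * (?D * transpose_mat G))"
    using cG cD cT by (simp add: assoc_mult_mat[of _ n n _ n _ n])
  also have "\<dots> = G * (?D * ((transpose_mat G * G) * (?D * transpose_mat G)))"
    using cG cD cT cDT mult_carrier_mat[OF cG cDT] by (simp add: assoc_mult_mat[of _ n n _ n _ n])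
  also have "\<dots> = G * (?D * (?D * transpose_mat G))"
    unfolding o using cDT by (simp add: left_mult_one_mat[of _ n n])
  also have "\<dots> = G * mat_diag n (\<lambda>i. (e i)\<^sup>2) * transpose_mat G"
  proof -
    have "?D * ?D = mat_diag n (\<lambda>i. (e i)\<^sup>2)" by (simp add: power2_eq_square)
    moreover have "?D * (?D * transpose_mat G) = (?D * ?D) * transpose_mat G"
      by (rule assoc_mult_mat[OF cD cD cT, symmetric])
    ultimately show ?thesis
      using cG cT by (simp add: assoc_mult_mat[of _ n n _ n _ n])
  qed
  finally have "char_poly (transpose_mat ?M * ?M) = (\<Prod>a\<leftarrow>map (\<lambda>i. (e i)\<^sup>2) [0..<n]. [:- a, 1:])"
    using diagonalized_char_poly[OF G] by simp
  then have "image_mset sqrt (proots (char_poly (transpose_mat ?M * ?M)))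
      = image_mset sqrt (mset (map (\<lambda>i. (e i)\<^sup>2) [0..<n]))"
    by (simp only: proots_prod_list_linear)
  also have "\<dots> = mset (map (\<lambda>i. sqrt ((e i)\<^sup>2)) [0..<n])"
    by (simp add: image_mset.compositionality o_def flip: mset_map)
  also have "map (\<lambda>i. sqrt ((e i)\<^sup>2)) [0..<n] = map e [0..<n]"
    using nonneg by simp
  \<comment> \<open>The reversed list is ascending, so sorting leaves it unchanged and the outer
    \<open>rev\<close> restores the decreasing order.\<close>
  also have "mset (map e [0..<n]) = mset (rev (map e [0..<n]))"
    by (rule mset_rev[symmetric])
  finally have "singular_values ?M = rev (sort (rev (map e [0..<n])))"
    unfolding singular_values_def by (simp only: sorted_list_of_multiset_mset)
  moreover have "sorted (rev (map e [0..<n]))"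
    using decr by (auto simp: sorted_iff_nth_mono rev_nth)
  ultimately show ?thesis by (simp only: sorted_sort_id rev_rev_ident)
qed

text \<open>The restriction is \<open>mat_diag r e\<close>, and the complementary factor collects
  the linear factors of index at least \<open>r\<close>. The bound in
  \<open>iteration_constant\<close> is stated for every dominant basis; this makes it available at
  \<open>first_cols G r\<close>.\<close>

lemma diagonalized_dominant_basis:
  assumes G: "orthonormal_cols n n G" and r: "r \<le> n"
    and nonneg: "\<And>i. i < n \<Longrightarrow> 0 \<le> e i"
    and gap: "\<And>i j. i < r \<Longrightarrow> r \<le> j \<Longrightarrow> j < n \<Longrightarrow> e j < e i"
  shows "dominant_basis n r (G * mat_diag n e * transpose_mat G) (first_cols G r)"
proof -
  let ?M = "G * mat_diag n e * transpose_mat G" and ?U = "first_cols G r"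
  let ?g = "\<Prod>a\<leftarrow>map e [r..<n]. [:- a, 1:]"
  have cG: "G \<in> carrier_mat n n" using G by (rule orthonormal_cols_carrier)
  have cU: "?U \<in> carrier_mat n r" using cG r by (rule first_cols_carrier)
  have cM: "?M \<in> carrier_mat n n" using cG by (rule diagonalized_carrier)
  have charS: "char_poly (mat_diag r e) = (\<Prod>a\<leftarrow>map e [0..<r]. [:- a, 1:])"
  proof -
    have "orthonormal_cols r r (1\<^sub>m r)" by (simp add: orthonormal_cols_def)
    from diagonalized_char_poly[OF this, of e] show ?thesis
      by (simp add: right_mult_one_mat[of _ r r] left_mult_one_mat[of _ r r])
  qed
  have "?M * ?U = ?U * mat_diag r e"
  proof (rule mat_col_eqI)
    fix j assume "j < dim_col (?U * mat_diag r e)"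
    then have j: "j < r" by (simp add: mat_diag_def)
    have colU: "col ?U j = col G j" by (rule col_first_cols[OF cG r j])
    have cj: "col G j \<in> carrier_vec n" using cG by (intro carrier_vecI) simp
    have "col (?M * ?U) j = ?M *\<^sub>v col G j"
      unfolding colU[symmetric] using cM cU j by (rule col_mult2)
    also have "\<dots> = e j \<cdot>\<^sub>v col G j"
    proof (rule orthonormal_cols_eqI[OF G])
      fix i assume i: "i < n"
      then show "col G i \<bullet> (?M *\<^sub>v col G j) = col G i \<bullet> (e j \<cdot>\<^sub>v col G j)"
        using G j r cG unfolding diagonalized_coord[OF G cj i] by (auto simp: orthonormal_cols_iff)
    qed (use cM cj in auto)
    also have "\<dots> = col (?U * mat_diag r e) j"
      unfolding colU[symmetric] using cU j
      by (intro eq_vecI) (auto simp: mat_diag_mult_right[OF cU])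
    finally show "col (?M * ?U) j = col (?U * mat_diag r e) j" .
  qed (use cM cU in \<open>auto simp: mat_diag_def\<close>)
  moreover have "char_poly ?M = char_poly (mat_diag r e) * ?g"
  proof -
    have "[0..<n] = [0..<r] @ [r..<n]" using r by (metis le_add_diff_inverse upt_add_eq_append zero_le)
    then show ?thesis unfolding diagonalized_char_poly[OF G] charS by simp
  qed
  moreover have "cmod y < cmod x"
    if x: "poly (map_poly complex_of_real (char_poly (mat_diag r e))) x = 0"
      and y: "poly (map_poly complex_of_real ?g) y = 0" for x y
  proof -
    obtain i where i: "i < r" "x = of_real (e i)"
      using x unfolding charS of_real_poly_prod_list by (auto simp: poly_prod_list prod_list_zero_iff)
    obtain j where j: "r \<le> j" "j < n" "y = of_real (e j)"
      using y unfolding of_real_poly_prod_list by (auto simp: poly_prod_list prod_list_zero_iff)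
    show ?thesis using gap[of i j] nonneg[of i] nonneg[of j] i j r by simp
  qed
  ultimately show ?thesis
    using orthonormal_first_cols[OF G r] unfolding dominant_basis_def
    by (intro conjI exI[of _ "mat_diag r e"] exI[of _ ?g]) auto
qed

text \<open>
  Counting roots with multiplicity, the restriction to the column space of \<open>U\<close> has exactly the
  eigenvalues \<open>e 0, ..., e (r - 1)\<close>, and these are simple eigenvalues of the whole matrix.
\<close>

lemma dominant_basis_projection_norm:
  assumes G: "orthonormal_cols n n G" and r: "r \<le> n"
    and nonneg: "\<And>i. i < n \<Longrightarrow> 0 \<le> e i"
    and strict: "\<And>i j. i < r \<Longrightarrow> i < j \<Longrightarrow> j < n \<Longrightarrow> e j < e i"
    and dom: "dominant_basis n r (G * mat_diag n e * transpose_mat G) U"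
    and v: "v \<in> carrier_vec n"
  shows "(transpose_mat U *\<^sub>v v) \<bullet> (transpose_mat U *\<^sub>v v) = (\<Sum>j<r. (col G j \<bullet> v)\<^sup>2)"
proof -
  let ?M = "G * mat_diag n e * transpose_mat G"
  have cG: "G \<in> carrier_mat n n" using G by (rule orthonormal_cols_carrier)
  have cM: "?M \<in> carrier_mat n n" using cG by (rule diagonalized_carrier)
  obtain S g where U: "orthonormal_cols n r U" and S: "S \<in> carrier_mat r r"
    and MU: "?M * U = U * S" and cp: "char_poly ?M = char_poly S * g"
    and sep: "\<And>x y. poly (map_poly complex_of_real (char_poly S)) x = 0 \<Longrightarrow>
      poly (map_poly complex_of_real g) y = 0 \<Longrightarrow> cmod y < cmod x"
    using dom unfolding dominant_basis_def by blast
  have cU: "U \<in> carrier_mat n r" using U by (rule orthonormal_cols_carrier)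
  have M0: "char_poly ?M \<noteq> 0" using degree_monic_char_poly[OF cM] by auto
  then have S0: "char_poly S \<noteq> 0" and g0: "g \<noteq> 0" using cp by auto
  have "proots (char_poly S) + proots g = mset (map e [0..<n])"
    using proots_mult[OF S0 g0] unfolding cp[symmetric] diagonalized_char_poly[OF G]
    by (simp only: proots_prod_list_linear)
  then have eq: "proots (char_poly S) + proots g = image_mset e (mset_set {..<n})"
    by (simp add: atLeast0LessThan)
  \<comment> \<open>\<open>proots\<close> could miss complex roots, but the degrees bound the two
    sizes by \<open>r\<close> and \<open>n - r\<close>, and together they account for all
    \<open>n\<close> real roots of \<open>char_poly ?M\<close>.\<close>
  have size_S: "size (proots (char_poly S)) = r"
  proof -
    have "size (proots (char_poly S)) \<le> r" using size_proots_le[of "char_poly S"] degree_monic_char_poly[OF S] by simp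
    moreover have "size (proots g) \<le> n - r"
    proof -
      have "degree (char_poly ?M) = degree (char_poly S) + degree g"
        unfolding cp by (rule degree_mult_eq[OF S0 g0])
      then show ?thesis
        using size_proots_le[of g] degree_monic_char_poly[OF S] degree_monic_char_poly[OF cM] by simp
    qed
    moreover have "size (proots (char_poly S)) + size (proots g) = n"
      using arg_cong[OF eq, of size] by simp
    ultimately show ?thesis using r by simp
  qed
  have sep': "y < x" if "x \<in># proots (char_poly S)" "y \<in># proots g" for x y
  proof -
    have "y \<in># image_mset e (mset_set {..<n})" "x \<in># image_mset e (mset_set {..<n})"
      using that unfolding eq[symmetric] by auto
    then have "0 \<le> y" "0 \<le> x" using nonneg by auto
    moreover have "poly (map_poly complex_of_real (char_poly S)) (of_real x) = 0"
      "poly (map_poly complex_of_real g) (of_real y) = 0"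
      using that S0 g0 by (auto simp: of_real_hom.poly_map_poly)
    ultimately show ?thesis using sep[of "of_real x" "of_real y"] by simp
  qed
  \<comment> \<open>Otherwise \<open>e l\<close> is a root of \<open>g\<close>, so all
    \<open>r\<close> roots of \<open>char_poly S\<close> exceed it; but strict decrease leaves at
    most \<open>l < r\<close> indices with a larger eigenvalue.\<close>
  have root: "poly (char_poly S) (e l) = 0" if l: "l < r" for l
  proof (rule ccontr)
    assume "\<not> ?thesis"
    then have "e l \<notin># proots (char_poly S)" using S0 by simp
    moreover have "e l \<in># image_mset e (mset_set {..<n})" using l r by auto
    ultimately have "e l \<in># proots g" unfolding eq[symmetric] by auto
    then have "filter_mset (\<lambda>x. e l < x) (proots (char_poly S)) = proots (char_poly S)"
      using sep' by (auto simp: filter_mset_eq_conv)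
    then have "proots (char_poly S) \<subseteq># filter_mset (\<lambda>x. e l < x) (image_mset e (mset_set {..<n}))"
      unfolding eq[symmetric] by simp
    then have "r \<le> size (filter_mset (\<lambda>x. e l < x) (image_mset e (mset_set {..<n})))"
      using size_S size_mset_mono by metis
    also have "\<dots> = card {i \<in> {..<n}. e l < e i}"
      by (simp add: filter_mset_image_mset)
    also have "\<dots> \<le> card {..<l}"
    proof (rule card_mono)
      show "{i \<in> {..<n}. e l < e i} \<subseteq> {..<l}"
        using strict[OF l] by (force simp: not_less_iff_gr_or_eq)
    qed simp
    finally show False using l by simp
  qed
  \<comment> \<open>An eigenvector of \<open>S\<close> is carried by \<open>U\<close> to an
    eigenvector of \<open>?M\<close>. Since \<open>e l\<close> is simple, the image is a multiple of
    \<open>col G l\<close>, which therefore lies in the column space of \<open>U\<close>.\<close>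
  have "\<exists>y\<in>carrier_vec r. U *\<^sub>v y = col G l" if l: "l < r" for l
  proof -
    have "eigenvalue S (e l)" using root[OF l] eigenvalue_root_char_poly[OF S] by simp
    then obtain y where y: "y \<in> carrier_vec r" "y \<noteq> 0\<^sub>v r" and Sy: "S *\<^sub>v y = e l \<cdot>\<^sub>v y"
      using S unfolding eigenvalue_def eigenvector_def by auto
    define w where "w = U *\<^sub>v y"
    have w: "w \<in> carrier_vec n" using cU y by (simp add: w_def)
    have Mw: "?M *\<^sub>v w = e l \<cdot>\<^sub>v w"
    proof -
      have "?M *\<^sub>v w = (?M * U) *\<^sub>v y"
        unfolding w_def using cM cU y by (intro assoc_mult_mat_vec[symmetric]) auto
      also have "\<dots> = U *\<^sub>v (S *\<^sub>v y)"
        unfolding MU using cU S y by (intro assoc_mult_mat_vec) auto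
      finally show ?thesis using cU y by (simp add: Sy w_def mult_mat_vec[of _ n r])
    qed
    have "col G i \<bullet> w = 0" if i: "i < n" "i \<noteq> l" for i
    proof -
      have "e i * (col G i \<bullet> w) = e l * (col G i \<bullet> w)"
        using diagonalized_coord[OF G w i(1), of e] cG i w unfolding Mw by auto
      moreover have "e i \<noteq> e l"
        using strict[of i l] strict[of l i] i l r by (cases "i < l") auto
      ultimately show ?thesis by auto
    qed
    then have w_eq: "w = (col G l \<bullet> w) \<cdot>\<^sub>v col G l"
    proof (intro orthonormal_cols_eqI[OF G w])
      fix j assume j: "j < n"
      assume *: "\<And>i. i < n \<Longrightarrow> i \<noteq> l \<Longrightarrow> col G i \<bullet> w = 0"
      show "col G j \<bullet> w = col G j \<bullet> ((col G l \<bullet> w) \<cdot>\<^sub>v col G l)"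
        using G *[OF j] j l r cG by (cases "j = l") (auto simp: orthonormal_cols_iff)
    qed (use cG l r in auto)
    have "w \<noteq> 0\<^sub>v n"
      using y scalar_prod_self_eq_0[OF y(1)] scalar_prod_self_eq_0[OF w] orthonormal_cols_norm[OF U y(1) y(1)]
      by (simp add: w_def)
    have nz: "col G l \<bullet> w \<noteq> 0"
    proof
      assume "col G l \<bullet> w = 0"
      then have "w = 0 \<cdot>\<^sub>v col G l" using w_eq by simp
      then have "w = 0\<^sub>v n" using cG by (auto intro!: eq_vecI)
      with \<open>w \<noteq> 0\<^sub>v n\<close> show False ..
    qed
    have "U *\<^sub>v ((1 / (col G l \<bullet> w)) \<cdot>\<^sub>v y) = (1 / (col G l \<bullet> w)) \<cdot>\<^sub>v w"
      using cU y by (simp add: w_def mult_mat_vec[of _ n r])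
    also have "\<dots> = (1 / (col G l \<bullet> w)) \<cdot>\<^sub>v ((col G l \<bullet> w) \<cdot>\<^sub>v col G l)"
      using w_eq by simp
    also have "\<dots> = col G l" using nz by (simp add: smult_smult_assoc)
    finally show ?thesis using y by (intro bexI[of _ "(1 / (col G l \<bullet> w)) \<cdot>\<^sub>v y"]) auto
  qed
  then obtain y where y: "\<And>l. l < r \<Longrightarrow> y l \<in> carrier_vec r" and Uy: "\<And>l. l < r \<Longrightarrow> U *\<^sub>v y l = col G l"
    by metis
  \<comment> \<open>\<open>Z\<close> is the change of basis with
    \<open>U * Z = first_cols G r\<close>. Being orthogonal, it preserves the norm of
    \<open>a\<close>, whose coordinates in \<open>Z\<close> are those of \<open>v\<close> along
    \<open>G\<close>.\<close>
  define Z where "Z = mat_of_cols r (map y [0..<r])"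
  have cZ: "Z \<in> carrier_mat r r"
    using mat_of_cols_carrier(1)[of r "map y [0..<r]"] by (simp add: Z_def)
  have colZ: "col Z l = y l" if "l < r" for l
    using that y by (simp add: Z_def)
  have oZ: "orthonormal_cols r r Z"
  proof -
    have "y i \<bullet> y j = (if i = j then 1 else 0)" if "i < r" "j < r" for i j
    proof -
      have "y i \<bullet> y j = col G i \<bullet> col G j"
        using orthonormal_cols_norm[OF U y y] that by (simp add: Uy)
      then show ?thesis using G that r by (simp add: orthonormal_cols_iff)
    qed
    then show ?thesis using cZ colZ by (simp add: orthonormal_cols_iff)
  qed
  define a where "a = transpose_mat U *\<^sub>v v"
  have a: "a \<in> carrier_vec r" using cU v by (simp add: a_def)
  have "col Z l \<bullet> a = col G l \<bullet> v" if l: "l < r" for l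
  proof -
    have "col Z l \<bullet> a = a \<bullet> col Z l" using colZ[OF l] y[OF l] a by (simp add: comm_scalar_prod)
    also have "\<dots> = v \<bullet> col G l"
      using transpose_vec_mult_scalar[OF cU y[OF l] v] by (simp add: a_def colZ[OF l] Uy[OF l])
    also have "\<dots> = col G l \<bullet> v" using v cG l r by (intro comm_scalar_prod) auto
    finally show ?thesis .
  qed
  then show ?thesis
    using orthonormal_cols_parseval[OF oZ a] by (simp add: a_def)
qed

subsection \<open>Convergence of subspace iteration\<close>

lemma sigma_diagonalized:
  assumes G: "orthonormal_cols n n G" and nonneg: "\<And>i. i < n \<Longrightarrow> 0 \<le> e i"
    and decr: "\<And>i j. i \<le> j \<Longrightarrow> j < n \<Longrightarrow> e j \<le> e i"
  shows "sigma p (G * mat_diag n e * transpose_mat G) = (if 1 \<le> p \<and> p \<le> n then e (p - 1) else 0)"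
  using diagonalized_singular_values[OF G nonneg decr] by (auto simp: sigma_def)

text \<open>
  The triangular factors accumulate to \<open>S\<close> with \<open>Q k * S = M ^ k * Q 0\<close>; in the eigenbasis,
  \<open>M ^ k\<close> scales the \<open>i\<close>-th coordinate by \<open>e i ^ k\<close>.
\<close>

lemma subspace_iteration_coords:
  assumes G: "orthonormal_cols n n G"
    and it: "subspace_iteration n r (G * mat_diag n e * transpose_mat G) Q"
    and Q0: "orthonormal_cols n r (Q 0)"
  shows "orthonormal_cols n r (Q k) \<and> (\<exists>S\<in>carrier_mat r r. \<forall>x\<in>carrier_vec r. \<forall>i<n.
    col G i \<bullet> (Q k *\<^sub>v (S *\<^sub>v x)) = e i ^ k * (col G i \<bullet> (Q 0 *\<^sub>v x)))"
proof (induction k)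
  case 0
  show ?case using Q0 by (intro conjI bexI[of _ "1\<^sub>m r"]) auto
next
  case (Suc k)
  let ?M = "G * mat_diag n e * transpose_mat G"
  have cM: "?M \<in> carrier_mat n n"
    using G by (intro diagonalized_carrier) (rule orthonormal_cols_carrier)
  obtain S where S: "S \<in> carrier_mat r r" and oQ: "orthonormal_cols n r (Q k)"
    and IH: "\<And>x i. x \<in> carrier_vec r \<Longrightarrow> i < n \<Longrightarrow>
      col G i \<bullet> (Q k *\<^sub>v (S *\<^sub>v x)) = e i ^ k * (col G i \<bullet> (Q 0 *\<^sub>v x))"
    using Suc by auto
  obtain S' where oQ': "orthonormal_cols n r (Q (Suc k))" and S': "S' \<in> carrier_mat r r"
    and step: "?M * Q k = Q (Suc k) * S'"
    using it unfolding subspace_iteration_def qr_factorization_def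
    by (metis diff_Suc_1 le_add1 plus_1_eq_Suc)
  have cQ: "Q k \<in> carrier_mat n r" and cQ': "Q (Suc k) \<in> carrier_mat n r"
    using oQ oQ' by (auto intro: orthonormal_cols_carrier)
  have "col G i \<bullet> (Q (Suc k) *\<^sub>v ((S' * S) *\<^sub>v x)) = e i ^ Suc k * (col G i \<bullet> (Q 0 *\<^sub>v x))"
    if x: "x \<in> carrier_vec r" and i: "i < n" for x i
  proof -
    have Sx: "S *\<^sub>v x \<in> carrier_vec r" using S x by simp
    have QSx: "Q k *\<^sub>v (S *\<^sub>v x) \<in> carrier_vec n" using cQ Sx by simp
    have "Q (Suc k) *\<^sub>v ((S' * S) *\<^sub>v x) = Q (Suc k) *\<^sub>v (S' *\<^sub>v (S *\<^sub>v x))"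
      using assoc_mult_mat_vec[OF S' S x] by simp
    also have "\<dots> = (Q (Suc k) * S') *\<^sub>v (S *\<^sub>v x)"
      using assoc_mult_mat_vec[OF cQ' S' Sx] by simp
    also have "\<dots> = ?M *\<^sub>v (Q k *\<^sub>v (S *\<^sub>v x))"
      unfolding step[symmetric] by (rule assoc_mult_mat_vec[OF cM cQ Sx])
    finally show ?thesis
      by (simp add: diagonalized_coord[OF G QSx i] IH[OF x i])
  qed
  then show ?case using oQ' S S' by (intro conjI bexI[of _ "S' * S"]) auto
qed

text \<open>The constant is \<open>sqrt K\<close>, with \<open>K\<close> bounding the inverse of
  \<open>W\<close>: the squared norm of \<open>Q 0 *\<^sub>v y\<close> is at most \<open>K\<close>
  times that of its leading \<open>r\<close> coordinates, and \<open>k\<close> steps scale the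
  trailing coordinates by at most \<open>e r ^ k\<close> and the leading ones by at least
  \<open>e (r - 1) ^ k\<close>.\<close>

lemma subspace_iteration_convergence:
  assumes G: "orthonormal_cols n n G" and r: "1 \<le> r" "r \<le> n"
    and nonneg: "\<And>i. i < n \<Longrightarrow> 0 \<le> e i"
    and decr: "\<And>i j. i \<le> j \<Longrightarrow> j < n \<Longrightarrow> e j \<le> e i"
    and strict: "\<And>i j. i < r \<Longrightarrow> i < j \<Longrightarrow> j < n \<Longrightarrow> e j < e i"
    and pos: "0 < e (r - 1)"
    and it: "subspace_iteration n r (G * mat_diag n e * transpose_mat G) Q"
    and Q0: "orthonormal_cols n r (Q 0)"
    and nonsing: "det (transpose_mat (first_cols G r) * Q 0) \<noteq> 0"
  shows "\<exists>c\<ge>0. iteration_constant n r (G * mat_diag n e * transpose_mat G) Q c"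
proof -
  let ?M = "G * mat_diag n e * transpose_mat G"
  define U where "U = first_cols G r"
  define W where "W = transpose_mat U * Q 0"
  \<comment> \<open>For \<open>r = n\<close> the value 0 matches \<open>sigma (r + 1)\<close>, which
    is past the end of the list.\<close>
  define \<rho> where "\<rho> = (if r < n then e r else 0) / e (r - 1)"
  have cG: "G \<in> carrier_mat n n" and cQ0: "Q 0 \<in> carrier_mat n r"
    using G Q0 by (auto intro: orthonormal_cols_carrier)
  have cU: "U \<in> carrier_mat n r" unfolding U_def using cG r by (intro first_cols_carrier)
  have cW: "W \<in> carrier_mat r r" using cU cQ0 by (simp add: W_def)
  have normU: "(transpose_mat U *\<^sub>v v) \<bullet> (transpose_mat U *\<^sub>v v) = (\<Sum>j<r. (col G j \<bullet> v)\<^sup>2)" for v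
    using transpose_mult_vec_norm[OF cU, of v] col_first_cols[OF cG r(2)] by (simp add: U_def)
  have rho: "\<bar>sigma (r + 1) ?M / sigma r ?M\<bar> = \<rho>"
    using r pos nonneg by (simp add: sigma_diagonalized[OF G nonneg decr] \<rho>_def)
  have rho0: "0 \<le> \<rho>" unfolding rho[symmetric] by simp
  obtain V where V: "V \<in> carrier_mat r r" "V * W = 1\<^sub>m r"
    using det_non_zero_imp_unit[OF cW] nonsing unfolding W_def[symmetric] U_def[symmetric]
    by (auto simp: Units_def ring_mat_simps)
  obtain K where K0: "0 \<le> K" and K: "\<And>x. x \<in> carrier_vec r \<Longrightarrow> (V *\<^sub>v x) \<bullet> (V *\<^sub>v x) \<le> K * (x \<bullet> x)"
    using mult_mat_vec_bounded[OF V(1)] by auto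
  have bound0: "y \<bullet> y \<le> K * (\<Sum>j<r. (col G j \<bullet> (Q 0 *\<^sub>v y))\<^sup>2)" if y: "y \<in> carrier_vec r" for y
  proof -
    have Wy: "W *\<^sub>v y \<in> carrier_vec r" using cW y by simp
    have "V *\<^sub>v (W *\<^sub>v y) = y" using assoc_mult_mat_vec[OF V(1) cW y] V(2) y by simp
    then have "y \<bullet> y \<le> K * ((W *\<^sub>v y) \<bullet> (W *\<^sub>v y))" using K[OF Wy] by simp
    also have "W *\<^sub>v y = transpose_mat U *\<^sub>v (Q 0 *\<^sub>v y)"
      unfolding W_def using cU cQ0 y by (intro assoc_mult_mat_vec) auto
    finally show ?thesis unfolding normU .
  qed
  have "subspace_tan U' (Q k) \<le> ereal (sqrt K * \<rho> ^ k)"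
    if dom: "dominant_basis n r ?M U'" and k: "1 \<le> k" for U' k
  proof (rule subspace_tan_le[OF _ _ r(1)])
    obtain S where oQ: "orthonormal_cols n r (Q k)" and S: "S \<in> carrier_mat r r"
      and coord: "\<And>x i. x \<in> carrier_vec r \<Longrightarrow> i < n \<Longrightarrow>
        col G i \<bullet> (Q k *\<^sub>v (S *\<^sub>v x)) = e i ^ k * (col G i \<bullet> (Q 0 *\<^sub>v x))"
      using subspace_iteration_coords[OF G it Q0, of k] by auto
    have cQ: "Q k \<in> carrier_mat n r" using oQ by (rule orthonormal_cols_carrier)
    show "orthonormal_cols n r (Q k)" by fact
    show "orthonormal_cols n r U'" using dom by (simp add: dominant_basis_def)
    show "0 \<le> sqrt K * \<rho> ^ k" using K0 rho0 by simp
    have ei: "0 < e i" if "i < r" for i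
      by (rule less_le_trans[OF pos decr]) (use that r in auto)
    \<comment> \<open>If \<open>S\<close> kills \<open>y\<close>, the leading coordinates of
      \<open>Q 0 *\<^sub>v y\<close> vanish because the \<open>e i ^ k\<close> are positive, and
      \<open>bound0\<close> forces \<open>y = 0\<close>. So every \<open>x\<close> has the form
      \<open>S *\<^sub>v y\<close>.\<close>
    have "det S \<noteq> 0"
    proof
      assume "det S = 0"
      then obtain y where y: "y \<in> carrier_vec r" "y \<noteq> 0\<^sub>v r" "S *\<^sub>v y = 0\<^sub>v r"
        using det_0_iff_vec_prod_zero[OF S] by auto
      have "col G i \<bullet> (Q 0 *\<^sub>v y) = 0" if i: "i < r" for i
      proof -
        have "Q k *\<^sub>v 0\<^sub>v r = 0\<^sub>v n" using cQ by (intro eq_vecI) auto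
        moreover have "col G i \<in> carrier_vec n" using cG by (intro carrier_vecI) simp
        ultimately have "col G i \<bullet> (Q k *\<^sub>v (S *\<^sub>v y)) = 0" using y by simp
        then show ?thesis using coord[OF y(1), of i] ei[OF i] i r by simp
      qed
      then have "y \<bullet> y \<le> 0" using bound0[OF y(1)] by simp
      then show False using y scalar_prod_self_eq_0[OF y(1)] scalar_prod_self_nonneg[of y] by simp
    qed
    then obtain S' where S': "S' \<in> carrier_mat r r" "S * S' = 1\<^sub>m r"
      using det_non_zero_imp_unit[OF S] by (auto simp: Units_def ring_mat_simps)
    fix x :: "real vec" assume x: "x \<in> carrier_vec r"
    define y where "y = S' *\<^sub>v x"
    have y: "y \<in> carrier_vec r" using S' x by (simp add: y_def)
    have Sy: "S *\<^sub>v y = x"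
      using assoc_mult_mat_vec[OF S S'(1) x] S'(2) x by (simp add: y_def)
    define w where "w i = col G i \<bullet> (Q 0 *\<^sub>v y)" for i
    have coordx: "col G i \<bullet> (Q k *\<^sub>v x) = e i ^ k * w i" if "i < n" for i
      using coord[OF y that] by (simp add: Sy w_def)
    have Qx: "Q k *\<^sub>v x \<in> carrier_vec n" using cQ x by simp
    have Q0y: "Q 0 *\<^sub>v y \<in> carrier_vec n" using cQ0 y by simp
    let ?s = "\<Sum>i<r. (e i ^ k * w i)\<^sup>2"
    have normU': "(transpose_mat U' *\<^sub>v (Q k *\<^sub>v x)) \<bullet> (transpose_mat U' *\<^sub>v (Q k *\<^sub>v x)) = ?s"
      using dominant_basis_projection_norm[OF G r(2) nonneg strict dom Qx] r coordx by simp
    have split: "(\<Sum>i<n. f i) = (\<Sum>i<r. f i) + (\<Sum>i\<in>{r..<n}. f i)" for f :: "nat \<Rightarrow> real"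
      using r by (subst sum.union_disjoint[symmetric]) (auto intro!: sum.cong)
    have xx: "x \<bullet> x = ?s + (\<Sum>i\<in>{r..<n}. (e i ^ k * w i)\<^sup>2)"
    proof -
      have "x \<bullet> x = (Q k *\<^sub>v x) \<bullet> (Q k *\<^sub>v x)"
        using orthonormal_cols_norm[OF oQ x x] by simp
      also have "\<dots> = (\<Sum>i<n. (e i ^ k * w i)\<^sup>2)"
        using orthonormal_cols_parseval[OF G Qx] coordx by simp
      finally show ?thesis unfolding split .
    qed
    define q where "q = (if r < n then e r else 0) ^ k"
    have q0: "0 \<le> q" using nonneg by (simp add: q_def)
    have "(\<Sum>i\<in>{r..<n}. (e i ^ k * w i)\<^sup>2) \<le> (\<Sum>i\<in>{r..<n}. q\<^sup>2 * (w i)\<^sup>2)"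
    proof (rule sum_mono)
      fix i assume i: "i \<in> {r..<n}"
      then have "e i ^ k \<le> q" using decr[of r i] nonneg by (auto simp: q_def intro!: power_mono)
      then have "(e i ^ k)\<^sup>2 \<le> q\<^sup>2" using nonneg[of i] i by (intro power_mono) auto
      then show "(e i ^ k * w i)\<^sup>2 \<le> q\<^sup>2 * (w i)\<^sup>2"
        unfolding power_mult_distrib by (rule mult_right_mono) simp
    qed
    also have "\<dots> \<le> q\<^sup>2 * (\<Sum>i<n. (w i)\<^sup>2)"
      unfolding split sum_distrib_left[symmetric] by (intro mult_left_mono) (auto intro: sum_nonneg)
    also have "(\<Sum>i<n. (w i)\<^sup>2) = y \<bullet> y"
      using orthonormal_cols_parseval[OF G Q0y] orthonormal_cols_norm[OF Q0 y y] by (simp add: w_def)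
    also have "q\<^sup>2 * (y \<bullet> y) \<le> q\<^sup>2 * (K * (\<Sum>i<r. (w i)\<^sup>2))"
      using bound0[OF y] by (intro mult_left_mono) (auto simp: w_def)
    \<comment> \<open>On leading coordinates \<open>e i \<ge> e (r - 1)\<close>, so replacing
      \<open>w i\<close> by \<open>e i ^ k * w i / e (r - 1) ^ k\<close> only enlarges the terms;
      the denominator turns \<open>q\<close> into \<open>\<rho> ^ k\<close>.\<close>
    also have "\<dots> \<le> q\<^sup>2 * (K * (\<Sum>i<r. ((e i ^ k * w i) / e (r - 1) ^ k)\<^sup>2))"
    proof (intro mult_left_mono sum_mono)
      fix i assume i: "i \<in> {..<r}"
      then have "1 \<le> e i ^ k / e (r - 1) ^ k"
        using decr[of i "r - 1"] pos r by (auto intro!: power_mono)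
      then have "1 * \<bar>w i\<bar> \<le> (e i ^ k / e (r - 1) ^ k) * \<bar>w i\<bar>" by (rule mult_right_mono) simp
      also have "\<dots> = \<bar>(e i ^ k * w i) / e (r - 1) ^ k\<bar>"
        using pos ei[of i] i by (simp add: abs_mult)
      finally show "(w i)\<^sup>2 \<le> ((e i ^ k * w i) / e (r - 1) ^ k)\<^sup>2"
        by (simp only: abs_le_square_iff[symmetric] mult_1)
    qed (use K0 in auto)
    also have "\<dots> = (sqrt K * \<rho> ^ k)\<^sup>2 * ?s"
      using K0 by (simp add: \<rho>_def q_def power_mult_distrib power_divide sum_divide_distrib[symmetric])
    finally show "x \<bullet> x \<le> (1 + (sqrt K * \<rho> ^ k)\<^sup>2) *
        ((transpose_mat U' *\<^sub>v (Q k *\<^sub>v x)) \<bullet> (transpose_mat U' *\<^sub>v (Q k *\<^sub>v x)))"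
      unfolding normU' xx by (simp add: algebra_simps)
  qed
  then show ?thesis
    using K0 unfolding iteration_constant_def rho by (intro exI[of _ "sqrt K"]) auto
qed

text \<open>Lets the constants of the three iterations be replaced by a common maximum.\<close>

lemma iteration_constant_mono:
  assumes "iteration_constant n r M Q c" "c \<le> c'"
  shows "iteration_constant n r M Q c'"
proof -
  have "ereal (c * \<bar>sigma (r + 1) M / sigma r M\<bar> ^ k) \<le> ereal (c' * \<bar>sigma (r + 1) M / sigma r M\<bar> ^ k)" for k
    using assms(2) by (simp add: mult_right_mono)
  then show ?thesis using assms(1) unfolding iteration_constant_def by (meson order.trans)
qed

subsection \<open>Haar distributed frames\<close>

text \<open>The last row is left free because the rotations used below change the leading block of
  size \<open>Suc k\<close> only there.\<close>

definition bordered_minor :: "nat \<Rightarrow> real mat \<Rightarrow> (nat \<Rightarrow> real) \<Rightarrow> real" where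
  "bordered_minor k X v =
     det (Matrix.mat (Suc k) (Suc k) (\<lambda>(i, j). if i < k then X $$ (i, j) else v j))"

text \<open>Laplace expansion along the last row: its cofactors do not see \<open>v\<close>, and the
  last of them is the leading minor of size \<open>k\<close>, the one known to be nonzero in the
  induction.\<close>

lemma bordered_minor_linear:
  "\<exists>cof. cof k = det (Matrix.mat k k (\<lambda>ij. X $$ ij)) \<and>
     (\<forall>v. bordered_minor k X v = (\<Sum>j<Suc k. v j * cof j))"
proof -
  define B where "B v = Matrix.mat (Suc k) (Suc k) (\<lambda>(i, j). if i < k then X $$ (i, j) else v j)"
    for v :: "nat \<Rightarrow> real"
  have cB: "B v \<in> carrier_mat (Suc k) (Suc k)" for v by (simp add: B_def)
  define cof where "cof j = cofactor (B (\<lambda>_. 0)) k j" for j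
  have del: "mat_delete (B v) k j = mat_delete (B (\<lambda>_. 0)) k j" if "j < Suc k" for v j
    using that by (intro eq_matI) (auto simp: mat_delete_def B_def)
  have "mat_delete (B (\<lambda>_. 0)) k k = Matrix.mat k k (\<lambda>ij. X $$ ij)"
    by (intro eq_matI) (auto simp: mat_delete_def B_def)
  then have "cof k = det (Matrix.mat k k (\<lambda>ij. X $$ ij))"
    by (simp add: cof_def cofactor_def flip: mult_2)
  moreover have "bordered_minor k X v = (\<Sum>j<Suc k. v j * cof j)" for v
  proof -
    have "bordered_minor k X v = (\<Sum>j<Suc k. B v $$ (k, j) * cofactor (B v) k j)"
      using laplace_expansion_row[OF cB, of k] by (simp add: bordered_minor_def B_def)
    also have "\<dots> = (\<Sum>j<Suc k. v j * cof j)"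
    proof (intro sum.cong refl)
      fix j assume "j \<in> {..<Suc k}"
      then show "B v $$ (k, j) * cofactor (B v) k j = v j * cof j"
        unfolding cof_def cofactor_def by (subst del) (auto simp: B_def)
    qed
    finally show ?thesis .
  qed
  ultimately show ?thesis by blast
qed

text \<open>Two rows coincide. This forces a nonvanishing coefficient of the later polynomial to
  have index at least \<open>k\<close>, where the moment curve has its entries.\<close>

lemma bordered_minor_row:
  assumes "l < k"
  shows "bordered_minor k X (\<lambda>j. X $$ (l, j)) = 0"
  unfolding bordered_minor_def using assms
  by (intro det_identical_rows[of _ "Suc k" l k]) (auto intro!: eq_vecI)

text \<open>
  The values of the bordered minor along the moment curve are those of a polynomial whose
  coefficients do not all vanish.
\<close>

lemma finite_bordered_minor_moment_curve:
  assumes X: "orthonormal_cols d r X" and k: "k < r"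
    and nz: "det (Matrix.mat k k (\<lambda>ij. X $$ ij)) \<noteq> 0"
  shows "finite {t. bordered_minor k X (\<lambda>j. \<Sum>l\<in>{k..<d}. real (Suc t) ^ l * X $$ (l, j)) = 0}"
proof -
  have cX: "X \<in> carrier_mat d r" using X by (rule orthonormal_cols_carrier)
  obtain cof where cofk: "cof k = det (Matrix.mat k k (\<lambda>ij. X $$ ij))"
    and lin: "\<And>v. bordered_minor k X v = (\<Sum>j<Suc k. v j * cof j)"
    using bordered_minor_linear[of k X] by blast
  \<comment> \<open>\<open>x\<close> is the cofactor vector padded by zeros, so that the minors
    \<open>z l\<close> bordered by rows of \<open>X\<close> are the entries of
    \<open>X *\<^sub>v x\<close>. The entry of \<open>x\<close> at \<open>k\<close> is the given
    nonzero minor, and the isometry \<open>X\<close> keeps the vector nonzero.\<close>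
  define x where "x = Matrix.vec r (\<lambda>j. if j < Suc k then cof j else 0)"
  have x: "x \<in> carrier_vec r" by (simp add: x_def)
  define z where "z l = bordered_minor k X (\<lambda>j. X $$ (l, j))" for l
  have zl: "(X *\<^sub>v x) $ l = z l" if "l < d" for l
  proof -
    have "(X *\<^sub>v x) $ l = (\<Sum>j<r. X $$ (l, j) * (if j < Suc k then cof j else 0))"
      using mult_mat_vec_sum_cols[OF cX x that] by (simp add: x_def)
    also have "\<dots> = (\<Sum>j<Suc k. X $$ (l, j) * cof j)"
      using k by (intro sum.mono_neutral_cong_right) auto
    finally show ?thesis by (simp add: z_def lin)
  qed
  have "x $ k \<noteq> 0" using cofk nz k by (simp add: x_def)
  then have "x \<noteq> 0\<^sub>v r" using k by auto
  then have "(X *\<^sub>v x) \<bullet> (X *\<^sub>v x) \<noteq> 0"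
    using orthonormal_cols_norm[OF X x x] scalar_prod_self_eq_0[OF x] by simp
  moreover have "X *\<^sub>v x \<in> carrier_vec d" using cX x by simp
  ultimately obtain l where l: "l < d" "z l \<noteq> 0"
    using zl by (auto simp: scalar_prod_self_sum elim!: sum.not_neutral_contains_not_neutral)
  have lk: "k \<le> l" using l bordered_minor_row[of l k X] by (force simp: z_def)
  define p where "p = (\<Sum>l\<in>{k..<d}. monom (z l) l)"
  have "coeff p l = z l"
    using l lk by (simp add: p_def coeff_sum)
  then have "p \<noteq> 0" using l by auto
  then have "finite {x. poly p x = 0}" by (rule poly_roots_finite)
  then have "finite ((\<lambda>t. real (Suc t)) -` {x. poly p x = 0})"
    by (rule finite_vimageI) (auto intro: injI)
  moreover have "bordered_minor k X (\<lambda>j. \<Sum>l\<in>{k..<d}. real (Suc t) ^ l * X $$ (l, j)) = poly p (real (Suc t))" for t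
  proof -
    have "bordered_minor k X (\<lambda>j. \<Sum>l\<in>{k..<d}. real (Suc t) ^ l * X $$ (l, j))
        = (\<Sum>j<Suc k. \<Sum>l\<in>{k..<d}. real (Suc t) ^ l * (X $$ (l, j) * cof j))"
      unfolding lin by (simp only: sum_distrib_right mult.assoc)
    also have "\<dots> = (\<Sum>l\<in>{k..<d}. \<Sum>j<Suc k. real (Suc t) ^ l * (X $$ (l, j) * cof j))"
      by (rule sum.swap)
    also have "\<dots> = (\<Sum>l\<in>{k..<d}. real (Suc t) ^ l * z l)"
      unfolding z_def lin by (simp only: sum_distrib_left)
    also have "\<dots> = poly p (real (Suc t))"
      by (simp only: p_def poly_sum poly_monom mult.commute)
    finally show ?thesis .
  qed
  ultimately show ?thesis by (simp add: vimage_def)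
qed

text \<open>Rows \<open>i < k\<close> of \<open>G\<close> are unit vectors and row \<open>k\<close>
  is the normalized moment vector, supported on coordinates from \<open>k\<close> on and hence
  orthogonal to them; the transpose of a completion supplies the rest.\<close>

lemma moment_curve_rotation:
  assumes k: "k < d"
  shows "\<exists>G a. orthonormal_cols d d G \<and> a \<noteq> 0 \<and> (\<forall>r. \<forall>X\<in>carrier_mat d r. \<forall>j<r.
    (\<forall>i<k. (G * X) $$ (i, j) = X $$ (i, j)) \<and>
    (G * X) $$ (k, j) = a * (\<Sum>l\<in>{k..<d}. real (Suc t) ^ l * X $$ (l, j)))"
proof -
  \<comment> \<open>The base \<open>Suc t\<close> is never 0, so the entry of \<open>v\<close> at
    \<open>k\<close> is nonzero for every \<open>t\<close>, including \<open>t = 0\<close>.\<close>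
  define v where "v = Matrix.vec d (\<lambda>i. if i < k then 0 else real (Suc t) ^ i)"
  have v: "v \<in> carrier_vec d" by (simp add: v_def)
  have "v $ k \<noteq> 0" using k by (simp add: v_def)
  then have "v \<noteq> 0\<^sub>v d" using k by auto
  then have vpos: "0 < v \<bullet> v"
    using scalar_prod_self_eq_0[OF v] scalar_prod_self_nonneg[of v] by linarith
  define a where "a = 1 / sqrt (v \<bullet> v)"
  have a: "a \<noteq> 0" "a * a * (v \<bullet> v) = 1" using vpos by (auto simp: a_def)
  define Y where "Y = Matrix.mat d (Suc k) (\<lambda>(i, j). if j < k then (if i = j then 1 else 0) else a * v $ i)"
  have cY: "Y \<in> carrier_mat d (Suc k)" by (simp add: Y_def)
  have colY: "col Y j = (if j < k then unit_vec d j else a \<cdot>\<^sub>v v)" if "j < Suc k" for j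
    using that k v by (auto simp: Y_def intro!: eq_vecI)
  have "orthonormal_cols d (Suc k) Y"
  proof -
    have "col Y i \<bullet> col Y j = (if i = j then 1 else 0)" if ij: "i < Suc k" "j < Suc k" for i j
    proof -
      have uv: "unit_vec d i \<bullet> (a \<cdot>\<^sub>v v) = 0" "(a \<cdot>\<^sub>v v) \<bullet> unit_vec d i = 0" if "i < k" for i
        using that k v by (auto simp: v_def)
      have vv: "(a \<cdot>\<^sub>v v) \<bullet> (a \<cdot>\<^sub>v v) = 1" using v a by (simp add: mult.assoc)
      show ?thesis
        using ij k uv vv by (cases "i < k"; cases "j < k") (auto simp: colY less_Suc_eq)
    qed
    then show ?thesis using cY by (simp add: orthonormal_cols_iff)
  qed
  from orthonormal_cols_completion[OF this]
  obtain H where H: "orthonormal_cols d d H" and HY: "\<And>j. j < Suc k \<Longrightarrow> col H j = col Y j"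
    by blast
  have cH: "H \<in> carrier_mat d d" using H by (rule orthonormal_cols_carrier)
  have "(\<forall>i<k. (transpose_mat H * X) $$ (i, j) = X $$ (i, j)) \<and>
    (transpose_mat H * X) $$ (k, j) = a * (\<Sum>l\<in>{k..<d}. real (Suc t) ^ l * X $$ (l, j))"
    if X: "X \<in> carrier_mat d r" and j: "j < r" for r j and X :: "real mat"
  proof (intro conjI allI impI)
    have cj: "col X j \<in> carrier_vec d" using X by (intro carrier_vecI) simp
    fix i assume i: "i < k"
    have "(transpose_mat H * X) $$ (i, j) = unit_vec d i \<bullet> col X j"
      using cH X i j k by (simp add: HY colY)
    then show "(transpose_mat H * X) $$ (i, j) = X $$ (i, j)"
      using X cj i j k by simp
  next
    have cj: "col X j \<in> carrier_vec d" using X by (intro carrier_vecI) simp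
    have "(transpose_mat H * X) $$ (k, j) = (a \<cdot>\<^sub>v v) \<bullet> col X j"
      using cH X j k by (simp add: HY colY)
    also have "\<dots> = a * (v \<bullet> col X j)" using v cj by simp
    also have "v \<bullet> col X j = (\<Sum>l<d. (if l < k then 0 else real (Suc t) ^ l) * X $$ (l, j))"
      using X j by (simp add: scalar_prod_def v_def atLeast0LessThan)
    also have "\<dots> = (\<Sum>l\<in>{k..<d}. real (Suc t) ^ l * X $$ (l, j))"
      by (intro sum.mono_neutral_cong_right) auto
    finally show "(transpose_mat H * X) $$ (k, j) = a * (\<Sum>l\<in>{k..<d}. real (Suc t) ^ l * X $$ (l, j))" .
  qed
  then show ?thesis
    using orthonormal_cols_transpose(2)[OF H] a(1) by (intro exI[of _ "transpose_mat H"] exI[of _ a]) auto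
qed

lemma bordered_minor_cmult:
  "bordered_minor k X (\<lambda>j. a * v j) = a * bordered_minor k X v"
proof -
  obtain cof where "\<And>v. bordered_minor k X v = (\<Sum>j<Suc k. v j * cof j)"
    using bordered_minor_linear[of k X] by blast
  then show ?thesis by (simp only: sum_distrib_left mult.assoc)
qed

text \<open>The tails \<open>A n\<close> decrease to the set of points lying in infinitely many
  \<open>F t\<close>, which is empty, yet each tail has probability at least
  \<open>p\<close>.\<close>

lemma (in prob_space) prob_eq_0_if_finitely_often:
  assumes F: "\<And>t :: nat. F t \<in> events" and p: "\<And>t. prob (F t) = p"
    and fin: "\<And>\<omega>. \<omega> \<in> space M \<Longrightarrow> finite {t. \<omega> \<in> F t}"
  shows "p = 0"
proof -
  define A where "A n = (\<Union>t\<in>{n..}. F t)" for n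
  have A: "A n \<in> events" for n using F by (auto simp: A_def)
  have "(\<lambda>n. prob (A n)) \<longlonglongrightarrow> prob (\<Inter>n. A n)"
    using A by (intro finite_Lim_measure_decseq) (auto simp: decseq_def A_def intro: order.trans)
  also have "(\<Inter>n. A n) = {}"
  proof (rule ccontr)
    assume "(\<Inter>n. A n) \<noteq> {}"
    then obtain \<omega> where \<omega>: "\<And>n. \<omega> \<in> A n" by auto
    then have "\<omega> \<in> space M" using A sets.sets_into_space by blast
    then obtain n where "\<And>t. \<omega> \<in> F t \<Longrightarrow> t < n"
      using fin[of \<omega>] by (auto simp: finite_nat_set_iff_bounded)
    then show False using \<omega>[of n] by (force simp: A_def)
  qed
  finally have "(\<lambda>n. prob (A n)) \<longlonglongrightarrow> 0" by simp
  moreover have "p \<le> prob (A n)" for n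
    unfolding p[of n, symmetric] using A by (intro finite_measure_mono) (auto simp: A_def)
  ultimately have "p \<le> 0" by (intro LIMSEQ_le_const) auto
  moreover have "0 \<le> p" unfolding p[of 0, symmetric] by simp
  ultimately show ?thesis by simp
qed

section \<open>Measurability and rotation of the random frame\<close>

lemma measurable_det_entries:
  assumes "k \<le> d" "k \<le> r"
  shows "(\<lambda>\<xi>. det (Matrix.mat k k \<xi>)) \<in> borel_measurable (entry_space d r)"
proof -
  have "(\<lambda>\<xi>. det (Matrix.mat k k \<xi>)) =
      (\<lambda>\<xi>. \<Sum>p | p permutes {0..<k}. signof p * (\<Prod>i = 0..<k. Matrix.mat k k \<xi> $$ (i, p i)))"
    by (intro ext det_def') simp
  also have "\<dots> = (\<lambda>\<xi>. \<Sum>p | p permutes {0..<k}. signof p * (\<Prod>i = 0..<k. \<xi> (i, p i)))"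
  proof (intro ext sum.cong refl arg_cong2[of _ _ _ _ "(*)"] prod.cong)
    fix \<xi> p i assume "p \<in> {p. p permutes {0..<k}}" "i \<in> {0..<k}"
    then show "Matrix.mat k k \<xi> $$ (i, p i) = \<xi> (i, p i)"
      using permutes_in_image[of p "{0..<k}" i] by auto
  qed
  finally have eq: "(\<lambda>\<xi>. det (Matrix.mat k k \<xi>)) =
      (\<lambda>\<xi>. \<Sum>p | p permutes {0..<k}. signof p * (\<Prod>i = 0..<k. \<xi> (i, p i)))" .
  show ?thesis
    unfolding eq
  proof (intro borel_measurable_sum borel_measurable_times borel_measurable_const borel_measurable_prod)
    fix p i assume p: "p \<in> {p. p permutes {0..<k}}" and i: "i \<in> {0..<k}"
    then have "p i \<in> {0..<k}" using permutes_in_image[of p "{0..<k}" i] by blast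
    then have "(i, p i) \<in> {..<d} \<times> {..<r}" using assms i by auto
    then show "(\<lambda>\<xi>. \<xi> (i, p i)) \<in> borel_measurable (entry_space d r)"
      by (rule measurable_component_singleton)
  qed
qed

lemma measurable_entries_mult:
  assumes X: "\<And>\<omega>. \<omega> \<in> space \<Omega> \<Longrightarrow> X \<omega> \<in> carrier_mat d r"
    and meas: "(\<lambda>\<omega>. entries d r (X \<omega>)) \<in> \<Omega> \<rightarrow>\<^sub>M entry_space d r"
    and G: "G \<in> carrier_mat d d"
  shows "(\<lambda>\<omega>. entries d r (G * X \<omega>)) \<in> \<Omega> \<rightarrow>\<^sub>M entry_space d r"
  unfolding entries_def
proof (rule measurable_restrict)
  fix ij assume "ij \<in> {..<d} \<times> {..<r}"
  then obtain i j where ij: "ij = (i, j)" "i < d" "j < r" by auto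
  have "(\<lambda>\<omega>. \<Sum>l<d. G $$ (i, l) * entries d r (X \<omega>) (l, j)) \<in> borel_measurable \<Omega>"
  proof (intro borel_measurable_sum borel_measurable_times borel_measurable_const)
    fix l assume "l \<in> {..<d}"
    then show "(\<lambda>\<omega>. entries d r (X \<omega>) (l, j)) \<in> borel_measurable \<Omega>"
      using ij by (intro measurable_compose[OF meas measurable_component_singleton]) auto
  qed
  also have "?this \<longleftrightarrow> (\<lambda>\<omega>. (G * X \<omega>) $$ ij) \<in> borel_measurable \<Omega>"
  proof (rule measurable_cong)
    fix \<omega> assume "\<omega> \<in> space \<Omega>"
    then show "(\<Sum>l<d. G $$ (i, l) * entries d r (X \<omega>) (l, j)) = (G * X \<omega>) $$ ij"
      using X[of \<omega>] G ij by (simp add: entries_def scalar_prod_def atLeast0LessThan)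
  qed
  finally show "(\<lambda>\<omega>. (G * X \<omega>) $$ ij) \<in> borel_measurable \<Omega>" .
qed

lemma haar_rotation_prob:
  assumes X: "haar_orthonormal \<Omega> d r X" and G: "orthonormal_cols d d G"
    and S: "S \<in> sets (entry_space d r)"
  shows "{\<omega> \<in> space \<Omega>. entries d r (G * X \<omega>) \<in> S} \<in> sets \<Omega>"
    and "measure \<Omega> {\<omega> \<in> space \<Omega>. entries d r (G * X \<omega>) \<in> S}
      = measure \<Omega> {\<omega> \<in> space \<Omega>. entries d r (X \<omega>) \<in> S}"
proof -
  have meas: "(\<lambda>\<omega>. entries d r (X \<omega>)) \<in> \<Omega> \<rightarrow>\<^sub>M entry_space d r"
    and inv: "distr \<Omega> (entry_space d r) (\<lambda>\<omega>. entries d r (G * X \<omega>)) =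
        distr \<Omega> (entry_space d r) (\<lambda>\<omega>. entries d r (X \<omega>))"
    using X G by (auto simp: haar_orthonormal_def)
  have measG: "(\<lambda>\<omega>. entries d r (G * X \<omega>)) \<in> \<Omega> \<rightarrow>\<^sub>M entry_space d r"
    using X G meas by (intro measurable_entries_mult) (auto simp: haar_orthonormal_def orthonormal_cols_def)
  have vimage: "{\<omega> \<in> space \<Omega>. f \<omega> \<in> S} = f -` S \<inter> space \<Omega>" for f :: "_ \<Rightarrow> nat \<times> nat \<Rightarrow> real"
    by auto
  show "{\<omega> \<in> space \<Omega>. entries d r (G * X \<omega>) \<in> S} \<in> sets \<Omega>"
    unfolding vimage using measG S by (rule measurable_sets)
  show "measure \<Omega> {\<omega> \<in> space \<Omega>. entries d r (G * X \<omega>) \<in> S}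
      = measure \<Omega> {\<omega> \<in> space \<Omega>. entries d r (X \<omega>) \<in> S}"
    using arg_cong[OF inv, of "\<lambda>N. measure N S"] meas measG S unfolding vimage
    by (simp add: measure_distr)
qed

lemma mat_entries:
  "k \<le> d \<Longrightarrow> k \<le> r \<Longrightarrow> Matrix.mat k k (entries d r X) = Matrix.mat k k (\<lambda>ij. X $$ ij)"
  by (intro eq_matI) (auto simp: entries_def)

lemma entries_in_space: "entries d r X \<in> space (entry_space d r)"
  by (auto simp: entries_def space_PiM)

text \<open>
  Rotations that fix the first \<open>k\<close> rows and move row \<open>k\<close> along the moment curve turn the event that
  the next minor vanishes into infinitely many equally likely events, of which only finitely many
  can occur at the same time.
\<close>

lemma haar_leading_minor_nonzero:
  assumes P: "prob_space \<Omega>" and X: "haar_orthonormal \<Omega> d r X" and k: "k \<le> r"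
  shows "AE \<omega> in \<Omega>. det (Matrix.mat k k (\<lambda>ij. X \<omega> $$ ij)) \<noteq> 0"
  using k
proof (induction k)
  case 0
  show ?case by simp
next
  case (Suc k)
  interpret prob_space \<Omega> by (rule P)
  have orth: "orthonormal_cols d r (X \<omega>)" if "\<omega> \<in> space \<Omega>" for \<omega>
    using X that by (auto simp: haar_orthonormal_def)
  obtain \<omega>0 where "\<omega>0 \<in> space \<Omega>" using not_empty by auto
  then have rd: "r \<le> d" using orth orthonormal_cols_le by blast
  have kd: "k < d" "k < r" "k \<le> d" "k \<le> r" "Suc k \<le> d" "Suc k \<le> r" using Suc.prems rd by auto
  define Rot where "Rot t G a \<longleftrightarrow> orthonormal_cols d d G \<and> a \<noteq> 0 \<and> (\<forall>X\<in>carrier_mat d r. \<forall>j<r.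
    (\<forall>i<k. (G * X) $$ (i, j) = X $$ (i, j)) \<and>
    (G * X) $$ (k, j) = a * (\<Sum>l\<in>{k..<d}. real (Suc t) ^ l * X $$ (l, j)))" for t G and a :: real
  have "\<exists>G a. Rot t G a" for t
    unfolding Rot_def using moment_curve_rotation[OF kd(1), of t] by blast
  then obtain G a where "\<And>t. Rot t (G t) (a t)" by metis
  then have G: "\<And>t. orthonormal_cols d d (G t)" and a: "\<And>t. a t \<noteq> 0"
    and rows: "\<And>t X i j. X \<in> carrier_mat d r \<Longrightarrow> j < r \<Longrightarrow> i < k \<Longrightarrow> (G t * X) $$ (i, j) = X $$ (i, j)"
    and row_k: "\<And>t X j. X \<in> carrier_mat d r \<Longrightarrow> j < r \<Longrightarrow>
      (G t * X) $$ (k, j) = a t * (\<Sum>l\<in>{k..<d}. real (Suc t) ^ l * X $$ (l, j))"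
    unfolding Rot_def by auto
  \<comment> \<open>Requiring the minor of size \<open>k\<close> to be nonzero inside the event
    makes the pointwise finiteness below hold at every \<open>\<omega>\<close>, not just almost
    everywhere.\<close>
  define S where "S = {\<xi> \<in> space (entry_space d r). det (Matrix.mat k k \<xi>) \<noteq> 0 \<and>
    det (Matrix.mat (Suc k) (Suc k) \<xi>) = 0}"
  have S: "S \<in> sets (entry_space d r)"
    unfolding S_def using measurable_det_entries[OF kd(3,4)] measurable_det_entries[OF kd(5,6)]
    by measurable
  define F where "F t = {\<omega> \<in> space \<Omega>. entries d r (G t * X \<omega>) \<in> S}" for t
  define F0 where "F0 = {\<omega> \<in> space \<Omega>. entries d r (X \<omega>) \<in> S}"
  have F: "F t \<in> events" "prob (F t) = prob F0" for t
    unfolding F_def F0_def by (rule haar_rotation_prob(1)[OF X G S]) (rule haar_rotation_prob(2)[OF X G S])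
  have "finite {t. \<omega> \<in> F t}" if \<omega>: "\<omega> \<in> space \<Omega>" for \<omega>
  proof (cases "det (Matrix.mat k k (\<lambda>ij. X \<omega> $$ ij)) = 0")
    \<comment> \<open>The rotations fix the first \<open>k\<close> rows, so their vanishing minor
      keeps every rotated copy out of \<open>S\<close>.\<close>
    case True
    have cX: "X \<omega> \<in> carrier_mat d r" using orth[OF \<omega>] by (rule orthonormal_cols_carrier)
    have "Matrix.mat k k (\<lambda>ij. (G t * X \<omega>) $$ ij) = Matrix.mat k k (\<lambda>ij. X \<omega> $$ ij)" for t
      using kd by (intro eq_matI) (auto simp: rows[OF cX] simp del: index_mult_mat)
    then have "{t. \<omega> \<in> F t} = {}"
      using True kd by (auto simp: F_def S_def mat_entries)
    then show ?thesis by (simp only: finite.emptyI)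
  next
    case False
    have cX: "X \<omega> \<in> carrier_mat d r" using orth[OF \<omega>] by (rule orthonormal_cols_carrier)
    have "det (Matrix.mat (Suc k) (Suc k) (\<lambda>ij. (G t * X \<omega>) $$ ij))
        = bordered_minor k (X \<omega>) (\<lambda>j. a t * (\<Sum>l\<in>{k..<d}. real (Suc t) ^ l * X \<omega> $$ (l, j)))" for t
      unfolding bordered_minor_def using kd
      by (intro arg_cong[of _ _ det] eq_matI)
        (auto simp: rows[OF cX] row_k[OF cX] less_Suc_eq simp del: index_mult_mat)
    \<comment> \<open>The normalizing factor \<open>a t\<close> only scales the minor and is
      nonzero, so the zeros are those of the unnormalized curve.\<close>
    then have "{t. \<omega> \<in> F t} \<subseteq>
        {t. bordered_minor k (X \<omega>) (\<lambda>j. \<Sum>l\<in>{k..<d}. real (Suc t) ^ l * X \<omega> $$ (l, j)) = 0}"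
      using a kd by (auto simp: F_def S_def mat_entries bordered_minor_cmult)
    then show ?thesis
      by (rule finite_subset) (rule finite_bordered_minor_moment_curve[OF orth[OF \<omega>] kd(2) False])
  qed
  then have "prob F0 = 0" using F by (intro prob_eq_0_if_finitely_often[of F]) auto
  moreover have "F0 \<in> events"
    unfolding F0_def using X S by (auto simp: haar_orthonormal_def)
  ultimately have "AE \<omega> in \<Omega>. \<omega> \<notin> F0" by (simp add: prob_eq_0)
  moreover have "AE \<omega> in \<Omega>. det (Matrix.mat k k (\<lambda>ij. X \<omega> $$ ij)) \<noteq> 0"
    using Suc by simp
  ultimately show ?case
  proof (rule AE_mp[OF AE_conjI], intro AE_I2 impI)
    fix \<omega> assume "\<omega> \<in> space \<Omega>" "\<omega> \<notin> F0 \<and> det (Matrix.mat k k (\<lambda>ij. X \<omega> $$ ij)) \<noteq> 0"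
    then show "det (Matrix.mat (Suc k) (Suc k) (\<lambda>ij. X \<omega> $$ ij)) \<noteq> 0"
      using kd by (auto simp: F0_def S_def mat_entries entries_in_space)
  qed
qed

text \<open>For an orthogonal completion \<open>H\<close> of \<open>U\<close>, the matrix
  \<open>transpose_mat U * X \<omega>\<close> is the leading block of
  \<open>transpose_mat H * X \<omega>\<close>, which is distributed like \<open>X\<close>. This
  reduces the claim to the leading minor of size \<open>r\<close>.\<close>

lemma haar_det_nonzero:
  assumes P: "prob_space \<Omega>" and X: "haar_orthonormal \<Omega> d r X" and U: "orthonormal_cols d r U"
  shows "AE \<omega> in \<Omega>. det (transpose_mat U * X \<omega>) \<noteq> 0"
proof -
  interpret prob_space \<Omega> by (rule P)
  have rd: "r \<le> d" using U by (rule orthonormal_cols_le)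
  obtain H where H: "orthonormal_cols d d H" and HU: "\<And>j. j < r \<Longrightarrow> col H j = col U j"
    using orthonormal_cols_completion[OF U] by blast
  define S where "S = {\<xi> \<in> space (entry_space d r). det (Matrix.mat r r \<xi>) = 0}"
  have S: "S \<in> sets (entry_space d r)"
    unfolding S_def using measurable_det_entries[OF rd order.refl] by measurable
  have "AE \<omega> in \<Omega>. entries d r (X \<omega>) \<notin> S"
    using haar_leading_minor_nonzero[OF P X order.refl]
    by (rule AE_mp) (auto simp: S_def mat_entries rd intro!: AE_I2)
  then have "prob {\<omega> \<in> space \<Omega>. entries d r (X \<omega>) \<in> S} = 0"
    by (intro prob_eq_0[THEN iffD2]) (use X S in \<open>auto simp: haar_orthonormal_def\<close>)
  then have "prob {\<omega> \<in> space \<Omega>. entries d r (transpose_mat H * X \<omega>) \<in> S} = 0"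
    using haar_rotation_prob(2)[OF X orthonormal_cols_transpose(2)[OF H] S] by simp
  then have "AE \<omega> in \<Omega>. \<omega> \<notin> {\<omega> \<in> space \<Omega>. entries d r (transpose_mat H * X \<omega>) \<in> S}"
    using haar_rotation_prob(1)[OF X orthonormal_cols_transpose(2)[OF H] S] by (simp only: prob_eq_0)
  then show ?thesis
  proof (rule AE_mp, intro AE_I2 impI)
    fix \<omega> assume \<omega>: "\<omega> \<in> space \<Omega>"
      and "\<omega> \<notin> {\<omega> \<in> space \<Omega>. entries d r (transpose_mat H * X \<omega>) \<in> S}"
    then have "det (Matrix.mat r r (\<lambda>ij. (transpose_mat H * X \<omega>) $$ ij)) \<noteq> 0"
      using rd by (auto simp: S_def mat_entries entries_in_space)
    moreover have "Matrix.mat r r (\<lambda>ij. (transpose_mat H * X \<omega>) $$ ij) = transpose_mat U * X \<omega>"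
    proof (rule eq_matI)
      have "X \<omega> \<in> carrier_mat d r"
        using X \<omega> by (auto simp: haar_orthonormal_def orthonormal_cols_def)
      then show "dim_row (Matrix.mat r r (\<lambda>ij. (transpose_mat H * X \<omega>) $$ ij)) = dim_row (transpose_mat U * X \<omega>)"
        "dim_col (Matrix.mat r r (\<lambda>ij. (transpose_mat H * X \<omega>) $$ ij)) = dim_col (transpose_mat U * X \<omega>)"
        "\<And>i j. i < dim_row (transpose_mat U * X \<omega>) \<Longrightarrow> j < dim_col (transpose_mat U * X \<omega>) \<Longrightarrow>
          Matrix.mat r r (\<lambda>ij. (transpose_mat H * X \<omega>) $$ ij) $$ (i, j) = (transpose_mat U * X \<omega>) $$ (i, j)"
        using H U rd HU by (auto simp: orthonormal_cols_def)
    qed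
    ultimately show "det (transpose_mat U * X \<omega>) \<noteq> 0" by simp
  qed
qed

subsection \<open>Slice matrices\<close>

lemma sum_if_const:
  "(\<Sum>c\<in>S. if P then f c else (0 :: real)) = (if P then \<Sum>c\<in>S. f c else 0)"
  by simp

lemma contract3_index:
  assumes "i < d" "j < d" "v \<in> carrier_vec d"
  shows "contract3 d T v $$ (i, j) = (\<Sum>c<d. T i j c * v $ c)"
proof -
  have "contract3 d T v $$ (i, j) = multilinear d T (1\<^sub>m d) (1\<^sub>m d) (mat_of_cols d [v]) i j 0"
    using assms by (simp add: contract3_def)
  also have "\<dots> = (\<Sum>a<d. \<Sum>b<d. \<Sum>c<d. if a = i then if b = j then T i j c * v $ c else 0 else 0)"
    using assms unfolding multilinear_def
    by (intro sum.cong refl) (simp add: mat_of_cols_index)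
  finally show ?thesis using assms by (simp only: sum_if_const sum.delta' sum.delta finite_lessThan lessThan_iff if_True)
qed

text \<open>Contractions in the other modes become third-mode contractions of a cyclically shifted
  tensor, so that only \<open>slice_mat_A\<close> has to be computed.\<close>

lemma contract1_eq_contract3:
  assumes "v \<in> carrier_vec d"
  shows "contract1 d T v = contract3 d (\<lambda>j k i. T i j k) v"
proof (rule eq_matI)
  fix j k assume "j < dim_row (contract3 d (\<lambda>j k i. T i j k) v)" "k < dim_col (contract3 d (\<lambda>j k i. T i j k) v)"
  then have jk: "j < d" "k < d" by (simp_all add: contract3_def)
  have "contract1 d T v $$ (j, k) = multilinear d T (mat_of_cols d [v]) (1\<^sub>m d) (1\<^sub>m d) 0 j k"
    using jk by (simp add: contract1_def)
  also have "\<dots> = (\<Sum>a<d. \<Sum>b<d. \<Sum>c<d. if c = k then if b = j then T a j k * v $ a else 0 else 0)"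
    using jk assms unfolding multilinear_def
    by (intro sum.cong refl) (simp add: mat_of_cols_index)
  also have "\<dots> = (\<Sum>a<d. \<Sum>b<d. if b = j then T a j k * v $ a else 0)"
    using jk by (simp add: sum.delta)
  also have "\<dots> = (\<Sum>a<d. T a j k * v $ a)" using jk by (simp add: sum.delta)
  finally show "contract1 d T v $$ (j, k) = contract3 d (\<lambda>j k i. T i j k) v $$ (j, k)"
    using jk assms by (simp add: contract3_index)
qed (simp_all add: contract1_def contract3_def)

text \<open>In the cyclic order the third mode comes before the first, which is why the contraction
  is transposed.\<close>

lemma transpose_contract2_eq_contract3:
  assumes "v \<in> carrier_vec d"
  shows "transpose_mat (contract2 d T v) = contract3 d (\<lambda>k i j. T i j k) v"
proof (rule eq_matI)
  fix k i assume "k < dim_row (contract3 d (\<lambda>k i j. T i j k) v)" "i < dim_col (contract3 d (\<lambda>k i j. T i j k) v)"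
  then have ik: "i < d" "k < d" by (simp_all add: contract3_def)
  have "contract2 d T v $$ (i, k) = multilinear d T (1\<^sub>m d) (mat_of_cols d [v]) (1\<^sub>m d) i 0 k"
    using ik by (simp add: contract2_def)
  also have "\<dots> = (\<Sum>a<d. \<Sum>b<d. \<Sum>c<d. if c = k then if a = i then T i b k * v $ b else 0 else 0)"
    using ik assms unfolding multilinear_def
    by (intro sum.cong refl) (simp add: mat_of_cols_index)
  also have "\<dots> = (\<Sum>a<d. \<Sum>b<d. if a = i then T i b k * v $ b else 0)"
    using ik by (simp add: sum.delta)
  also have "\<dots> = (\<Sum>a<d. if a = i then \<Sum>b<d. T i b k * v $ b else 0)"
    by (intro sum.cong refl) auto
  also have "\<dots> = (\<Sum>b<d. T i b k * v $ b)" using ik by (simp add: sum.delta)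
  finally show "transpose_mat (contract2 d T v) $$ (k, i) = contract3 d (\<lambda>k i j. T i j k) v $$ (k, i)"
    using ik assms by (simp add: contract3_index contract2_def)
qed (simp_all add: contract2_def contract3_def)

lemma symmetric_tensor_cyclic_imp:
  assumes "symmetric_tensor d T"
  shows "symmetric_tensor d (\<lambda>j k i. T i j k)"
proof -
  have s: "T i j k = T j i k" "T i j k = T i k j" if "i < d" "j < d" "k < d" for i j k
    using assms that by (auto simp: symmetric_tensor_def)
  have "T k i j = T k j i \<and> T k i j = T j i k" if "i < d" "j < d" "k < d" for i j k
  proof
    show "T k i j = T k j i" using that by (intro s(2))
    have "T k i j = T i k j" using that by (intro s(1))
    also have "\<dots> = T i j k" using that by (intro s(2))
    also have "\<dots> = T j i k" using that by (intro s(1))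
    finally show "T k i j = T j i k" .
  qed
  then show ?thesis unfolding symmetric_tensor_def by blast
qed

text \<open>Three cyclic shifts are the identity, so the one-sided implication closes up to an
  equivalence.\<close>

lemma symmetric_tensor_cyclic:
  "symmetric_tensor d (\<lambda>j k i. T i j k) = symmetric_tensor d T"
  "symmetric_tensor d (\<lambda>k i j. T i j k) = symmetric_tensor d T"
  using symmetric_tensor_cyclic_imp[of d T] symmetric_tensor_cyclic_imp[of d "\<lambda>j k i. T i j k"]
    symmetric_tensor_cyclic_imp[of d "\<lambda>k i j. T i j k"]
  by blast+

lemma slice_mat_B_eq: "slice_mat_B d T = slice_mat_A d (\<lambda>j k i. T i j k)"
proof -
  have unit: "contract1 d T (unit_vec d i) = contract3 d (\<lambda>j k i. T i j k) (unit_vec d i)" for i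
    by (rule contract1_eq_contract3) simp
  have vec: "contract1 d T (Matrix.vec d f) = contract3 d (\<lambda>j k i. T i j k) (Matrix.vec d f)" for f
    by (rule contract1_eq_contract3) simp
  show ?thesis
    unfolding slice_mat_A_def slice_mat_B_def symmetric_tensor_cyclic(1)[of d T] vec unit ..
qed

lemma mat_trace_transpose: "X \<in> carrier_mat n n \<Longrightarrow> mat_trace (transpose_mat X) = mat_trace X"
  by (auto simp: mat_trace_def)

lemma slice_mat_C_eq: "slice_mat_C d T = slice_mat_A d (\<lambda>k i j. T i j k)"
proof -
  have t: "contract2 d T v = transpose_mat (contract3 d (\<lambda>k i j. T i j k) v)" if "v \<in> carrier_vec d" for v
    using arg_cong[OF transpose_contract2_eq_contract3[OF that, of T], where f = transpose_mat] by simp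
  have tr: "mat_trace (contract2 d T v) = mat_trace (contract3 d (\<lambda>k i j. T i j k) v)"
    if "v \<in> carrier_vec d" for v
    unfolding t[OF that] by (rule mat_trace_transpose[of _ d]) (simp add: contract3_def)
  have unit: "transpose_mat (contract2 d T (unit_vec d i)) = contract3 d (\<lambda>k i j. T i j k) (unit_vec d i)"
    "contract2 d T (unit_vec d i) = transpose_mat (contract3 d (\<lambda>k i j. T i j k) (unit_vec d i))"
    "mat_trace (contract2 d T (unit_vec d i)) = mat_trace (contract3 d (\<lambda>k i j. T i j k) (unit_vec d i))" for i
    by (rule transpose_contract2_eq_contract3[OF unit_vec_carrier], rule t[OF unit_vec_carrier],
        rule tr[OF unit_vec_carrier])
  have vec: "transpose_mat (contract2 d T (Matrix.vec d f)) = contract3 d (\<lambda>k i j. T i j k) (Matrix.vec d f)" for f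
    by (rule transpose_contract2_eq_contract3) simp
  show ?thesis
    unfolding slice_mat_A_def slice_mat_C_def symmetric_tensor_cyclic(2)[of d T] vec unit(1,3) unfolding unit(2) ..
qed

lemma cp_decomposition_cyclic:
  assumes "cp_decomposition d R T lam A B C"
  shows "cp_decomposition d R (\<lambda>j k i. T i j k) lam B C A"
    and "cp_decomposition d R (\<lambda>k i j. T i j k) lam C A B"
  using assms unfolding cp_decomposition_def by (simp_all add: mult_ac)

text \<open>The isometry property in coordinates, in the form in which products of slices
  appear.\<close>

lemma orthonormal_cols_sum_mult:
  assumes X: "orthonormal_cols n m X"
  shows "(\<Sum>s<n. (\<Sum>l<m. f l * X $$ (s, l)) * (\<Sum>l<m. g l * X $$ (s, l))) = (\<Sum>l<m. f l * g l)"
proof -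
  have cX: "X \<in> carrier_mat n m" using X by (rule orthonormal_cols_carrier)
  have entry: "(X *\<^sub>v Matrix.vec m h) $ s = (\<Sum>l<m. h l * X $$ (s, l))" if "s < n" for h s
    using mult_mat_vec_sum_cols[OF cX _ that, of "Matrix.vec m h"] by (simp add: mult.commute)
  have "(X *\<^sub>v Matrix.vec m f) \<bullet> (X *\<^sub>v Matrix.vec m g)
      = (\<Sum>s<n. (X *\<^sub>v Matrix.vec m f) $ s * (X *\<^sub>v Matrix.vec m g) $ s)"
    using cX by (simp add: scalar_prod_def atLeast0LessThan)
  also have "\<dots> = (\<Sum>s<n. (\<Sum>l<m. f l * X $$ (s, l)) * (\<Sum>l<m. g l * X $$ (s, l)))"
    by (intro sum.cong refl) (simp add: entry)
  finally show ?thesis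
    using orthonormal_cols_norm[OF X, of "Matrix.vec m f" "Matrix.vec m g"]
    by (simp add: scalar_prod_def atLeast0LessThan)
qed

text \<open>Without symmetry, orthonormality of \<open>B\<close> collapses the matrix product, and
  the unit columns of \<open>C\<close> collapse the sum over slices. With symmetry, the trace vector
  contributes \<open>lam (l + 1) * ab l\<close>, and \<open>ab l\<close> turns each column of
  \<open>B\<close> into that of \<open>A\<close>.\<close>

lemma slice_mat_A_index:
  assumes cp: "cp_decomposition d R T lam A B C" and A: "orthonormal_cols d R A"
    and B: "orthonormal_cols d R B" and C: "orthonormal_cols d R C"
    and lam: "\<And>l. l < R \<Longrightarrow> lam (l + 1) \<noteq> 0" and pq: "p < d" "q < d"
  shows "slice_mat_A d T $$ (p, q) = (\<Sum>l<R. (lam (l + 1))\<^sup>2 * A $$ (p, l) * A $$ (q, l))"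
proof -
  have cC: "C \<in> carrier_mat d R" and cB: "B \<in> carrier_mat d R"
    using B C by (auto intro: orthonormal_cols_carrier)
  have c3: "contract3 d T v $$ (i, j) = (\<Sum>l<R. (lam (l + 1) * (col C l \<bullet> v) * A $$ (i, l)) * B $$ (j, l))"
    if "i < d" "j < d" "v \<in> carrier_vec d" for i j v
  proof -
    have "contract3 d T v $$ (i, j)
        = (\<Sum>c<d. \<Sum>l<R. lam (l + 1) * A $$ (i, l) * B $$ (j, l) * (C $$ (c, l) * v $ c))"
      using that cp by (simp add: contract3_index cp_decomposition_def sum_distrib_right mult.assoc)
    also have "\<dots> = (\<Sum>l<R. \<Sum>c<d. lam (l + 1) * A $$ (i, l) * B $$ (j, l) * (C $$ (c, l) * v $ c))"
      by (rule sum.swap)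
    also have "\<dots> = (\<Sum>l<R. lam (l + 1) * A $$ (i, l) * B $$ (j, l) * (\<Sum>c<d. C $$ (c, l) * v $ c))"
      by (simp only: sum_distrib_left)
    also have "\<dots> = (\<Sum>l<R. (lam (l + 1) * (col C l \<bullet> v) * A $$ (i, l)) * B $$ (j, l))"
      using cC that by (intro sum.cong refl) (simp add: scalar_prod_def atLeast0LessThan mult_ac)
    finally show ?thesis .
  qed
  have c3_unit: "contract3 d T (unit_vec d c) $$ (i, j)
      = (\<Sum>l<R. (lam (l + 1) * C $$ (c, l) * A $$ (i, l)) * B $$ (j, l))"
    if "i < d" "j < d" "c < d" for i j c
    unfolding c3[OF that(1,2) unit_vec_carrier] using cC that
    by (intro sum.cong refl) (simp add: carrier_vec_def)
  have dim3: "contract3 d T v \<in> carrier_mat d d" for v by (simp add: contract3_def)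
  have normal: "(\<Sum>s<d. X $$ (s, l) * X $$ (s, l)) = 1" if "orthonormal_cols d R X" "l < R" for X l
  proof -
    have "col X l \<bullet> col X l = 1" "X \<in> carrier_mat d R" using that by (auto simp: orthonormal_cols_iff)
    then show ?thesis using that by (simp add: scalar_prod_def atLeast0LessThan)
  qed
  show ?thesis
  proof (cases "symmetric_tensor d T")
    case False
    have "slice_mat_A d T $$ (p, q)
        = (\<Sum>c<d. \<Sum>s<d. contract3 d T (unit_vec d c) $$ (p, s) * contract3 d T (unit_vec d c) $$ (q, s))"
      using False pq by (simp add: slice_mat_A_def sum_mats_def scalar_prod_def atLeast0LessThan
          carrier_matD[OF dim3])
    also have "\<dots> = (\<Sum>c<d. \<Sum>l<R. (lam (l + 1) * C $$ (c, l) * A $$ (p, l)) * (lam (l + 1) * C $$ (c, l) * A $$ (q, l)))"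
      using pq orthonormal_cols_sum_mult[OF B] by (simp add: c3_unit)
    also have "\<dots> = (\<Sum>l<R. \<Sum>c<d. (lam (l + 1))\<^sup>2 * A $$ (p, l) * A $$ (q, l) * (C $$ (c, l) * C $$ (c, l)))"
      by (subst sum.swap) (simp add: power2_eq_square mult_ac)
    also have "\<dots> = (\<Sum>l<R. (lam (l + 1))\<^sup>2 * A $$ (p, l) * A $$ (q, l))"
      by (intro sum.cong refl) (simp add: normal[OF C] flip: sum_distrib_left)
    finally show ?thesis .
  next
    case True
    define ab where "ab l = (\<Sum>s<d. A $$ (s, l) * B $$ (s, l))" for l
    define v where "v = Matrix.vec d (\<lambda>i. mat_trace (contract3 d T (unit_vec d i)))"
    have v: "v \<in> carrier_vec d" by (simp add: v_def)
    have v_nth: "v $ c = (\<Sum>l<R. (lam (l + 1) * ab l) * C $$ (c, l))" if c: "c < d" for c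
    proof -
      have "v $ c = (\<Sum>s<d. \<Sum>l<R. lam (l + 1) * C $$ (c, l) * (A $$ (s, l) * B $$ (s, l)))"
        using c by (simp add: v_def mat_trace_def carrier_matD[OF dim3] c3_unit mult.assoc)
      also have "\<dots> = (\<Sum>l<R. \<Sum>s<d. lam (l + 1) * C $$ (c, l) * (A $$ (s, l) * B $$ (s, l)))"
        by (rule sum.swap)
      also have "\<dots> = (\<Sum>l<R. (lam (l + 1) * ab l) * C $$ (c, l))"
        unfolding ab_def sum_distrib_left sum_distrib_right by (simp add: mult_ac)
      finally show ?thesis .
    qed
    \<comment> \<open>Writing a single column as a sum with Kronecker coefficients makes the
      bilinear identity for \<open>C\<close> applicable.\<close>
    have delta: "(\<Sum>k<R. (if k = l then 1 else 0) * f k) = f l" if "l < R" for l and f :: "nat \<Rightarrow> real"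
      using that by (simp add: if_distrib[of "\<lambda>x. x * _"] cong: if_cong)
    have Cv: "col C l \<bullet> v = lam (l + 1) * ab l" if l: "l < R" for l
    proof -
      have "col C l \<bullet> v = (\<Sum>c<d. (\<Sum>k<R. (if k = l then 1 else 0) * C $$ (c, k)) *
          (\<Sum>k<R. (lam (k + 1) * ab k) * C $$ (c, k)))"
        using cC v l by (simp add: scalar_prod_def atLeast0LessThan v_nth delta)
      also have "\<dots> = lam (l + 1) * ab l"
        unfolding orthonormal_cols_sum_mult[OF C] by (rule delta[OF l])
      finally show ?thesis .
    qed
    \<comment> \<open>Contracting with \<open>col C l\<close> isolates one rank one term, which
      inherits the symmetry of \<open>T\<close>; the nonzero weight cancels.\<close>
    have swap: "A $$ (i, l) * B $$ (j, l) = A $$ (j, l) * B $$ (i, l)"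
      if ij: "i < d" "j < d" and l: "l < R" for i j l
    proof -
      have cl: "col C l \<in> carrier_vec d" using cC by (intro carrier_vecI) simp
      have "contract3 d T (col C l) $$ (i, j) = lam (l + 1) * (A $$ (i, l) * B $$ (j, l))"
        if "i < d" "j < d" for i j
      proof -
        have "contract3 d T (col C l) $$ (i, j)
            = (\<Sum>k<R. (if k = l then 1 else 0) * (lam (k + 1) * (A $$ (i, k) * B $$ (j, k))))"
          unfolding c3[OF that cl] using C l
          by (intro sum.cong refl) (simp add: orthonormal_cols_iff)
        then show ?thesis unfolding delta[OF l] .
      qed
      moreover have "contract3 d T (col C l) $$ (i, j) = contract3 d T (col C l) $$ (j, i)"
        using True ij cl by (simp add: contract3_index symmetric_tensor_def)
      ultimately show ?thesis using ij lam[OF l] by simp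
    qed
    \<comment> \<open>Exchanging the indices of \<open>A\<close> and \<open>B\<close> inside the
      inner product leaves the squared norm of a column of \<open>B\<close>, which is 1.\<close>
    have abB: "ab l * B $$ (q, l) = A $$ (q, l)" if l: "l < R" for l
    proof -
      have "ab l * B $$ (q, l) = (\<Sum>s<d. (A $$ (s, l) * B $$ (q, l)) * B $$ (s, l))"
        unfolding ab_def sum_distrib_right by (simp add: mult_ac)
      also have "\<dots> = (\<Sum>s<d. A $$ (q, l) * (B $$ (s, l) * B $$ (s, l)))"
        using swap[OF _ pq(2) l] by (intro sum.cong refl) (simp add: mult.assoc)
      also have "\<dots> = A $$ (q, l)" by (simp add: normal[OF B l] flip: sum_distrib_left)
      finally show ?thesis .
    qed
    have "slice_mat_A d T $$ (p, q) = (\<Sum>l<R. (lam (l + 1) * (col C l \<bullet> v) * A $$ (p, l)) * B $$ (q, l))"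
      using True c3[OF pq v] by (simp add: slice_mat_A_def v_def)
    also have "\<dots> = (\<Sum>l<R. (lam (l + 1))\<^sup>2 * A $$ (p, l) * (ab l * B $$ (q, l)))"
      by (intro sum.cong refl) (simp add: Cv power2_eq_square)
    finally show ?thesis using abB by simp
  qed
qed

text \<open>Completing \<open>A\<close> to an orthogonal matrix supplies eigenvectors for the
  eigenvalue 0, hence the padding of the spectrum beyond \<open>R\<close>.\<close>

lemma slice_mat_A_diagonalized:
  assumes cp: "cp_decomposition d R T lam A B C" and A: "orthonormal_cols d R A"
    and B: "orthonormal_cols d R B" and C: "orthonormal_cols d R C"
    and lam: "\<And>l. l < R \<Longrightarrow> lam (l + 1) \<noteq> 0"
  shows "\<exists>G. orthonormal_cols d d G \<and> (\<forall>j<R. col G j = col A j) \<and>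
    slice_mat_A d T = G * mat_diag d (\<lambda>i. if i < R then (lam (i + 1))\<^sup>2 else 0) * transpose_mat G"
proof -
  obtain G where G: "orthonormal_cols d d G" and GA: "\<And>j. j < R \<Longrightarrow> col G j = col A j"
    using orthonormal_cols_completion[OF A] by blast
  have Rd: "R \<le> d" using A by (rule orthonormal_cols_le)
  have cG: "G \<in> carrier_mat d d" and cA: "A \<in> carrier_mat d R"
    using G A by (auto intro: orthonormal_cols_carrier)
  have GA': "G $$ (i, j) = A $$ (i, j)" if "i < d" "j < R" for i j
    using arg_cong[OF GA[OF that(2)], of "\<lambda>v. v $ i"] that cG cA Rd by simp
  let ?e = "\<lambda>i. if i < R then (lam (i + 1))\<^sup>2 else 0"
  have "slice_mat_A d T = G * mat_diag d ?e * transpose_mat G"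
  proof (rule eq_matI)
    fix p q assume "p < dim_row (G * mat_diag d ?e * transpose_mat G)"
      "q < dim_col (G * mat_diag d ?e * transpose_mat G)"
    then have pq: "p < d" "q < d" using cG by auto
    have "(G * mat_diag d ?e * transpose_mat G) $$ (p, q) = (\<Sum>l<d. G $$ (p, l) * ?e l * G $$ (q, l))"
      unfolding mat_diag_mult_right[OF cG] using cG pq
      by (simp add: scalar_prod_def atLeast0LessThan)
    also have "\<dots> = (\<Sum>l<R. (lam (l + 1))\<^sup>2 * A $$ (p, l) * A $$ (q, l))"
      using Rd pq by (intro sum.mono_neutral_cong_right) (auto simp: GA')
    finally show "slice_mat_A d T $$ (p, q) = (G * mat_diag d ?e * transpose_mat G) $$ (p, q)"
      using slice_mat_A_index[OF cp A B C lam pq] by simp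
  next
    show "dim_row (slice_mat_A d T) = dim_row (G * mat_diag d ?e * transpose_mat G)"
      "dim_col (slice_mat_A d T) = dim_col (G * mat_diag d ?e * transpose_mat G)"
      using cG by (simp_all add: slice_mat_A_def contract3_def sum_mats_def)
  qed
  with G GA show ?thesis by blast
qed

section \<open>The number of steps and the initialization\<close>

lemma geometric_bound_less_1:
  fixes c q :: real
  assumes c: "1 \<le> c" and q: "0 < q" "q < 1" and J: "1 \<le> J" and le: "ln c / ln (1 / q) \<le> real J"
  shows "c * (q\<^sup>2) ^ J < 1"
proof -
  have lnq: "0 < ln (1 / q)" using q by simp
  have "ln c \<le> real J * ln (1 / q)" using le lnq by (simp add: divide_le_eq)
  also have "\<dots> = ln ((1 / q) ^ J)" using q by (simp add: ln_realpow)
  finally have "c \<le> (1 / q) ^ J" using c q by (subst (asm) ln_le_cancel_iff) auto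
  then have "c * q ^ J \<le> 1" using q by (simp add: power_divide le_divide_eq)
  \<comment> \<open>One factor \<open>q ^ J\<close> has absorbed \<open>c\<close>; the other is
    strictly below 1 since \<open>J \<ge> 1\<close>.\<close>
  then have "(c * q ^ J) * q ^ J \<le> 1 * q ^ J" using q by (intro mult_right_mono) auto
  also have "\<dots> < 1" using q J by (simp add: power_less_one_iff)
  finally show ?thesis by (simp add: power2_eq_square power_mult_distrib mult.assoc)
qed

text \<open>Randomness is confined to the existence of a constant; the second claim is deterministic
  and applies to any sequence that admits one. The tensor is generic so that cyclic shifts yield the
  other two modes.\<close>

lemma slice_mat_A_initialization:
  assumes P: "prob_space \<Omega>" and r: "1 \<le> r" "r \<le> R"
    and dec: "\<forall>i. 1 \<le> i \<and> i < R \<longrightarrow> lam (i + 1) < lam i" and pos: "0 < lam R" and last: "lam (R + 1) = 0"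
    and A: "orthonormal_cols d R A" and B: "orthonormal_cols d R B" and C: "orthonormal_cols d R C"
    and cp: "cp_decomposition d R T lam A B C"
    and haar: "haar_orthonormal \<Omega> d r (Q 0)"
    and it: "\<forall>\<omega>\<in>space \<Omega>. subspace_iteration d r (slice_mat_A d T) (\<lambda>j. Q j \<omega>)"
  shows "AE \<omega> in \<Omega>. \<exists>c. iteration_constant d r (slice_mat_A d T) (\<lambda>j. Q j \<omega>) c"
    and "1 \<le> c \<Longrightarrow> iteration_constant d r (slice_mat_A d T) Q' c \<Longrightarrow> 1 \<le> J \<Longrightarrow>
      step_scale lam r c \<le> real J \<Longrightarrow> subspace_tan (first_cols A r) (Q' J) < 1"
proof -
  define e where "e i = (if i < R then (lam (i + 1))\<^sup>2 else 0)" for i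
  have e_eq: "e = (\<lambda>i. if i < R then (lam (i + 1))\<^sup>2 else 0)" by (simp add: e_def fun_eq_iff)
  have lam_strict: "lam j < lam i" if "1 \<le> i" "i < j" "j \<le> R" for i j
    using that(2,3)
  proof (induction j)
    case (Suc j)
    have "lam (Suc j) < lam j" using dec Suc.prems that(1) by auto
    with Suc show ?case by (cases "i = j") auto
  qed simp
  have lam_pos: "0 < lam i" if "1 \<le> i" "i \<le> R" for i
    using lam_strict[of i R] that pos by (cases "i = R") auto
  have lam_nz: "lam (l + 1) \<noteq> 0" if "l < R" for l using lam_pos[of "l + 1"] that by simp
  have Rd: "R \<le> d" using A by (rule orthonormal_cols_le)
  have rd: "r \<le> d" using r Rd by simp
  have cA: "A \<in> carrier_mat d R" using A by (rule orthonormal_cols_carrier)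
  obtain G where G: "orthonormal_cols d d G" and GA: "\<And>j. j < R \<Longrightarrow> col G j = col A j"
    and M: "slice_mat_A d T = G * mat_diag d e * transpose_mat G"
    using slice_mat_A_diagonalized[OF cp A B C lam_nz] unfolding e_eq by blast
  have cG: "G \<in> carrier_mat d d" using G by (rule orthonormal_cols_carrier)
  have first: "first_cols A r = first_cols G r"
  proof (rule mat_col_eqI)
    fix j assume "j < dim_col (first_cols G r)"
    then have "j < r" using carrier_matD(2)[OF first_cols_carrier[OF cG rd]] by simp
    then show "col (first_cols A r) j = col (first_cols G r) j"
      using col_first_cols[OF cA r(2)] col_first_cols[OF cG rd] GA r by simp
  next
    show "dim_row (first_cols A r) = dim_row (first_cols G r)" "dim_col (first_cols A r) = dim_col (first_cols G r)"
      by (simp_all only: carrier_matD[OF first_cols_carrier[OF cG rd]] carrier_matD[OF first_cols_carrier[OF cA r(2)]])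
  qed
  have nonneg: "0 \<le> e i" if "i < d" for i by (simp add: e_def)
  have strict: "e j < e i" if "i < r" "i < j" "j < d" for i j
    using that r lam_strict[of "i + 1" "j + 1"] lam_pos[of "i + 1"] lam_pos[of "j + 1"]
    by (auto simp: e_def intro!: power_strict_mono)
  have decr: "e j \<le> e i" if "i \<le> j" "j < d" for i j
  proof (cases "i < j \<and> j < R")
    case True
    then show ?thesis
      using lam_strict[of "i + 1" "j + 1"] lam_pos[of "j + 1"] by (auto simp: e_def intro!: power_mono)
  next
    case False
    then show ?thesis using that by (cases "i = j") (auto simp: e_def)
  qed
  have pos_r: "0 < e (r - 1)" using r lam_pos[of r] by (simp add: e_def)
  show "AE \<omega> in \<Omega>. \<exists>c. iteration_constant d r (slice_mat_A d T) (\<lambda>j. Q j \<omega>) c"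
    using haar_det_nonzero[OF P haar orthonormal_first_cols[OF G rd]]
  proof (rule AE_mp, intro AE_I2 impI)
    fix \<omega> assume \<omega>: "\<omega> \<in> space \<Omega>" and nonsing: "det (transpose_mat (first_cols G r) * Q 0 \<omega>) \<noteq> 0"
    have "orthonormal_cols d r (Q 0 \<omega>)" using haar \<omega> by (auto simp: haar_orthonormal_def)
    then show "\<exists>c. iteration_constant d r (slice_mat_A d T) (\<lambda>j. Q j \<omega>) c"
      using subspace_iteration_convergence[where e = e and Q = "\<lambda>j. Q j \<omega>",
          OF G r(1) rd nonneg decr strict pos_r bspec[OF it \<omega>, unfolded M] _ nonsing]
      unfolding M by blast
  qed
  assume c: "1 \<le> c" and const: "iteration_constant d r (slice_mat_A d T) Q' c"
    and J: "1 \<le> J" and steps: "step_scale lam r c \<le> real J"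
  have dom: "dominant_basis d r (slice_mat_A d T) (first_cols A r)"
    unfolding M first by (rule diagonalized_dominant_basis[where e = e, OF G rd nonneg strict]) auto
  have ratio: "\<bar>sigma (r + 1) (slice_mat_A d T) / sigma r (slice_mat_A d T)\<bar> = (lam (r + 1) / lam r)\<^sup>2"
  proof -
    have sig: "sigma p (slice_mat_A d T) = (if 1 \<le> p \<and> p \<le> d then e (p - 1) else 0)" for p
      unfolding M by (rule sigma_diagonalized[OF G nonneg decr])
    \<comment> \<open>For \<open>r = R\<close> both sides are 0: \<open>sigma (R + 1)\<close> is a
      padding eigenvalue or, if \<open>R = d\<close>, past the end of the list, and
      \<open>lam (R + 1) = 0\<close> by convention.\<close>
    have "sigma (r + 1) (slice_mat_A d T) = (lam (r + 1))\<^sup>2"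
      unfolding sig using r Rd last
      by (cases "r = R") (auto simp: e_def)
    moreover have "sigma r (slice_mat_A d T) = (lam r)\<^sup>2"
      unfolding sig using r rd by (simp add: e_def)
    ultimately show ?thesis by (simp add: power_divide)
  qed
  have "c * ((lam (r + 1) / lam r)\<^sup>2) ^ J < 1"
  proof (cases "lam (r + 1) = 0")
    \<comment> \<open>Only possible for \<open>r = R\<close>. The step scale is then 0, and the
      bound vanishes because \<open>0 ^ J = 0\<close> for \<open>J \<ge> 1\<close>.\<close>
    case True
    then show ?thesis using J by (simp add: power_0_left)
  next
    case False
    then have "r < R" using r last by (cases "r = R") auto
    then have "0 < lam (r + 1)" "lam (r + 1) < lam r" "0 < lam r"
      using lam_pos[of "r + 1"] lam_strict[of r "r + 1"] lam_pos[of r] r by auto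
    then show ?thesis using geometric_bound_less_1[OF c _ _ J, of "lam (r + 1) / lam r"] steps False
      by (simp add: step_scale_def)
  qed
  then show "subspace_tan (first_cols A r) (Q' J) < 1"
    using const dom J unfolding iteration_constant_def ratio
    by (metis ereal_less_eq(3) le_less_trans less_ereal.simps(1) one_ereal_def)
qed

theorem theorem5p3:
  "\<exists>K > (0 :: real).
     \<forall>(\<Omega> :: 'w measure) (d :: nat) (R :: nat) (r :: nat) (T :: tensor) (lam :: nat \<Rightarrow> real)
       (A :: real mat) (B :: real mat) (C :: real mat)
       (QA :: nat \<Rightarrow> 'w \<Rightarrow> real mat) (QB :: nat \<Rightarrow> 'w \<Rightarrow> real mat) (QC :: nat \<Rightarrow> 'w \<Rightarrow> real mat).
       prob_space \<Omega> \<and>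
       1 \<le> r \<and> r \<le> R \<and>
       (\<forall>i. 1 \<le> i \<and> i < R \<longrightarrow> lam (i + 1) < lam i) \<and> 0 < lam R \<and> lam (R + 1) = 0 \<and>
       orthonormal_cols d R A \<and> orthonormal_cols d R B \<and> orthonormal_cols d R C \<and>
       cp_decomposition d R T lam A B C \<and>
       haar_orthonormal \<Omega> d r (QA 0) \<and> haar_orthonormal \<Omega> d r (QB 0) \<and>
       haar_orthonormal \<Omega> d r (QC 0) \<and>
       (\<forall>\<omega> \<in> space \<Omega>.
          subspace_iteration d r (slice_mat_A d T) (\<lambda>j. QA j \<omega>) \<and>
          subspace_iteration d r (slice_mat_B d T) (\<lambda>j. QB j \<omega>) \<and>
          subspace_iteration d r (slice_mat_C d T) (\<lambda>j. QC j \<omega>))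
       \<longrightarrow>
       (AE \<omega> in \<Omega>.
          let admissible = (\<lambda>c :: real. 1 \<le> c \<and>
                iteration_constant d r (slice_mat_A d T) (\<lambda>j. QA j \<omega>) c \<and>
                iteration_constant d r (slice_mat_B d T) (\<lambda>j. QB j \<omega>) c \<and>
                iteration_constant d r (slice_mat_C d T) (\<lambda>j. QC j \<omega>) c)
          in (\<exists>c. admissible c) \<and>
             (\<forall>c. admissible c \<longrightarrow>
                (\<forall>J :: nat. 1 \<le> J \<and> K * step_scale lam r c \<le> real J \<longrightarrow>
                   subspace_tan (first_cols A r) (QA J \<omega>) < 1 \<and>
                   subspace_tan (first_cols B r) (QB J \<omega>) < 1 \<and>
                   subspace_tan (first_cols C r) (QC J \<omega>) < 1)))"
proof (intro exI[of _ 1] conjI allI impI)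
  show "(0 :: real) < 1" by simp
next
  fix \<Omega> :: "'w measure" and d R r T lam A B C
  fix QA QB QC :: "nat \<Rightarrow> 'w \<Rightarrow> real mat"
  assume H: "prob_space \<Omega> \<and>
       1 \<le> r \<and> r \<le> R \<and>
       (\<forall>i. 1 \<le> i \<and> i < R \<longrightarrow> lam (i + 1) < lam i) \<and> 0 < lam R \<and> lam (R + 1) = 0 \<and>
       orthonormal_cols d R A \<and> orthonormal_cols d R B \<and> orthonormal_cols d R C \<and>
       cp_decomposition d R T lam A B C \<and>
       haar_orthonormal \<Omega> d r (QA 0) \<and> haar_orthonormal \<Omega> d r (QB 0) \<and>
       haar_orthonormal \<Omega> d r (QC 0) \<and>
       (\<forall>\<omega> \<in> space \<Omega>.
          subspace_iteration d r (slice_mat_A d T) (\<lambda>j. QA j \<omega>) \<and>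
          subspace_iteration d r (slice_mat_B d T) (\<lambda>j. QB j \<omega>) \<and>
          subspace_iteration d r (slice_mat_C d T) (\<lambda>j. QC j \<omega>))"
  then have P: "prob_space \<Omega>" and r: "1 \<le> r" "r \<le> R"
    and dec: "\<forall>i. 1 \<le> i \<and> i < R \<longrightarrow> lam (i + 1) < lam i" and pos: "0 < lam R" and last: "lam (R + 1) = 0"
    and A: "orthonormal_cols d R A" and B: "orthonormal_cols d R B" and C: "orthonormal_cols d R C"
    and cp: "cp_decomposition d R T lam A B C"
    and haar: "haar_orthonormal \<Omega> d r (QA 0)" "haar_orthonormal \<Omega> d r (QB 0)" "haar_orthonormal \<Omega> d r (QC 0)"
    and it: "\<forall>\<omega>\<in>space \<Omega>. subspace_iteration d r (slice_mat_A d T) (\<lambda>j. QA j \<omega>)"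
      "\<forall>\<omega>\<in>space \<Omega>. subspace_iteration d r (slice_mat_B d T) (\<lambda>j. QB j \<omega>)"
      "\<forall>\<omega>\<in>space \<Omega>. subspace_iteration d r (slice_mat_C d T) (\<lambda>j. QC j \<omega>)"
    by auto
  note init_A = slice_mat_A_initialization[where Q = QA and T = T, OF P r dec pos last A B C cp
      haar(1) it(1)]
  \<comment> \<open>The shift turns the factors \<open>A\<close>, \<open>B\<close>, \<open>C\<close>
    into \<open>B\<close>, \<open>C\<close>, \<open>A\<close>, and folding identifies the slice
    matrix of the shifted tensor with \<open>slice_mat_B\<close>.\<close>
  note init_B = slice_mat_A_initialization[where Q = QB and T = "\<lambda>j k i. T i j k", OF P r dec pos last
      B C A cp_decomposition_cyclic(1)[OF cp] haar(2), folded slice_mat_B_eq[of d T], OF it(2)]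
  note init_C = slice_mat_A_initialization[where Q = QC and T = "\<lambda>k i j. T i j k", OF P r dec pos last
      C A B cp_decomposition_cyclic(2)[OF cp] haar(3), folded slice_mat_C_eq[of d T], OF it(3)]
  let ?admissible = "\<lambda>\<omega> c. 1 \<le> c \<and>
    iteration_constant d r (slice_mat_A d T) (\<lambda>j. QA j \<omega>) c \<and>
    iteration_constant d r (slice_mat_B d T) (\<lambda>j. QB j \<omega>) c \<and>
    iteration_constant d r (slice_mat_C d T) (\<lambda>j. QC j \<omega>) c"
  have "AE \<omega> in \<Omega>. \<exists>c. ?admissible \<omega> c"
    using init_A(1) init_B(1) init_C(1)
  proof eventually_elim
    case (elim \<omega>)
    then obtain cA cB cC where "iteration_constant d r (slice_mat_A d T) (\<lambda>j. QA j \<omega>) cA"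
      "iteration_constant d r (slice_mat_B d T) (\<lambda>j. QB j \<omega>) cB"
      "iteration_constant d r (slice_mat_C d T) (\<lambda>j. QC j \<omega>) cC"
      by blast
    \<comment> \<open>The 1 in the maximum secures \<open>1 \<le> c\<close>; enlarging a constant
      keeps it admissible for each iteration.\<close>
    then show ?case
      by (intro exI[of _ "max 1 (max cA (max cB cC))"] conjI) (auto elim!: iteration_constant_mono)
  qed
  then show "AE \<omega> in \<Omega>.
          let admissible = (\<lambda>c :: real. 1 \<le> c \<and>
                iteration_constant d r (slice_mat_A d T) (\<lambda>j. QA j \<omega>) c \<and>
                iteration_constant d r (slice_mat_B d T) (\<lambda>j. QB j \<omega>) c \<and>
                iteration_constant d r (slice_mat_C d T) (\<lambda>j. QC j \<omega>) c)
          in (\<exists>c. admissible c) \<and>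
             (\<forall>c. admissible c \<longrightarrow>
                (\<forall>J :: nat. 1 \<le> J \<and> 1 * step_scale lam r c \<le> real J \<longrightarrow>
                   subspace_tan (first_cols A r) (QA J \<omega>) < 1 \<and>
                   subspace_tan (first_cols B r) (QB J \<omega>) < 1 \<and>
                   subspace_tan (first_cols C r) (QC J \<omega>) < 1))"
  proof eventually_elim
    case (elim \<omega>)
    then show ?case
      unfolding Let_def using init_A(2) init_B(2) init_C(2) by (simp only: mult_1) blast
  qed
qed

end
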